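(* Let $p$ be a prime. (1) $\rho_p(2,3)=\frac{13831}{19773}$ if $p=3$; $\rho_p(2,3)=1-2p^{-1}\frac{1-p^{-1}}{1-p^{-3}}$ if $p\equiv 1\pmod 3$; $\rho_p(2,3)=1-6p^{-3}\left(\frac{1-p^{-1}}{1-p^{-3}}\right)^3$ if $p\equiv 2\pmod 3$. (2) $\rho_p(3,3)=\frac{6391}{6591}$ if $p=3$; $\rho_p(3,3)=1-\frac{8}{3}p^{-2}(1+p^{-1})^2\left(\frac{1-p^{-1}}{1-p^{-3}}\right)^3$ if $p\equiv1\pmod 3$; $\rho_p(3,3)=1$ if $p\equiv 2\pmod 3$. (3) $\rho_p(4,3)=1-\frac{40}{3}p^{-4}\left(\frac{1-p^{-1}}{1-p^{-3}}\right)^4$ if $p\equiv 1\pmod 3$, and $\rho_p(4,3)=1$ otherwise. (4) $\rho_p(5,3)=1-\frac{80}{3}p^{-6}\left(\frac{1-p^{-1}}{1-p^{-3}}\right)^6$ if $p\equiv 1\pmod 3$, and $\rho_p(5,3)=1$ otherwise. (5) If $n\ge 6$, then $\rho_p(n,3)=1$.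
   Context: For $n,k\in\mathbb{Z}_{\ge 2}$ and $\mathbf a=(a_0,\dots,a_n)$, let $X^k_{\mathbf a}\subset\mathbb{P}^n$ denote the diagonal hypersurface $\sum_{i=0}^n a_ix_i^k=0$. For a prime $p$ let $\mu_p$ be the Haar measure on $\mathbb{Z}_p$ normalized by $\mu_p(\mathbb{Z}_p)=1$, and also the product measure on $\mathbb{Z}_p^{n+1}$. Define $\rho_p(n,k)=\mu_p(\{\mathbf a\in\mathbb{Z}_p^{n+1}: X^k_{\mathbf a}(\mathbb{Q}_p)\neq\emptyset\})$. *)

theory Defs
  imports "HOL-Probability.Probability" "HOL-Number_Theory.Number_Theory"
begin

text \<open>A p-adic integer is represented by its sequence of base-p digits
  d :: nat => nat (with d j < p); its reduction modulo p^m is the integer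
  sum_{j<m} d j * p^j.  A vector (a_0,...,a_n) in Z_p^(n+1) is represented by
  a :: nat * nat => nat, where a (i,j) is the j-th digit of a_i.\<close>

definition zp_trunc :: "nat \<Rightarrow> (nat \<Rightarrow> nat) \<Rightarrow> nat \<Rightarrow> int" where
  "zp_trunc p d m = (\<Sum>j<m. int (d j) * int p ^ j)"

text \<open>X^k_a(Q_p) is nonempty iff there is a nonzero x in Z_p^(n+1) (clear
  denominators, the equation being homogeneous) with sum a_i x_i^k = 0 in Z_p,
  i.e. (Z_p being the inverse limit of Z/p^m) the equation holds modulo p^m
  for every m.\<close>

definition diag_Qp_point :: "nat \<Rightarrow> nat \<Rightarrow> nat \<Rightarrow> (nat \<times> nat \<Rightarrow> nat) \<Rightarrow> bool" where
  "diag_Qp_point p n k a \<longleftrightarrow>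
     (\<exists>x :: nat \<times> nat \<Rightarrow> nat.
        (\<forall>i j. x (i, j) < p) \<and>
        (\<exists>i\<le>n. \<exists>j. x (i, j) \<noteq> 0) \<and>
        (\<forall>m. [(\<Sum>i\<le>n. zp_trunc p (\<lambda>j. a (i, j)) m * zp_trunc p (\<lambda>j. x (i, j)) m ^ k) = 0]
               (mod (int p ^ m))))"

text \<open>Normalized Haar measure on Z_p^(n+1): the digits are independent and
  uniformly distributed on {0..p-1}.\<close>

definition haar_Zp_vec :: "nat \<Rightarrow> nat \<Rightarrow> (nat \<times> nat \<Rightarrow> nat) measure" where
  "haar_Zp_vec p n = PiM ({..n} \<times> UNIV) (\<lambda>_. measure_pmf (pmf_of_set {..<p}))"

definition rho :: "nat \<Rightarrow> nat \<Rightarrow> nat \<Rightarrow> real" where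
  "rho p n k = measure (haar_Zp_vec p n)
      {a \<in> space (haar_Zp_vec p n). diag_Qp_point p n k a}"

end

theory Submission
  imports Defs
begin

text \<open>
  Write a nonzero coefficient as \<open>a\<^sub>i = p^(v\<^sub>i) * L\<^sub>i\<close> with \<open>L\<^sub>i\<close> a unit. Scaling variables by powers of
  \<open>p\<close> and Hensel's lemma show that solubility depends only on the types \<open>(v\<^sub>i mod 3, class of L\<^sub>i
  modulo cubes)\<close>; there are 3 classes of units if \<open>p = 3\<close> or \<open>p \<equiv> 1 (mod 3)\<close>, and one otherwise.
  Comparing terms of minimal valuation, the form is insoluble iff the types are pairwise distinct and,
  in addition, for \<open>p \<equiv> 1\<close> no three valuations agree modulo 3 (a diagonal cubic curve over
  the field with \<open>p\<close> elements always has a point), and for \<open>p = 3\<close> no valuation class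
  that occurs twice is followed by an occurring one (modulo 9, sums of two units of different classes
  realise \<open>\<plusminus>3\<close>, while \<open>\<plusminus>1 \<plusminus> 2 \<plusminus> 4\<close> never vanishes).
  The types of the coefficients are independent, of probability \<open>p^(-r) (1 - 1/p) / (1 - 1/p^3)\<close>
  divided by the number of classes, so the insoluble probability is \<open>(n + 1)!\<close> times a sum over the
  sets of \<open>n + 1\<close> types with these properties.
\<close>

section \<open>Coherent sequences and Hensel's lemma\<close>

text \<open>Why one small congruence decides solubility: in \<open>a * (y + t * P ^ s) ^ 3\<close>
  with \<open>y\<close> a unit, \<open>v\<close> the valuation of \<open>a\<close> and
  \<open>e\<close> that of \<open>3\<close>, the linear term has valuation at least
  \<open>v + e + s\<close>, the quadratic one again carries the factor \<open>3\<close>, and the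
  cubic one has exponent \<open>v + 3 * s\<close>. As \<open>e \<le> 1\<close>, a root to precision
  \<open>v + e + 1\<close> already lifts, where the general lemma would ask for
  \<open>2 * (v + e) + 1\<close>. Division by the least valuation leaves a congruence modulo
  \<open>P ^ (e + 1)\<close>, so unit parts are needed modulo \<open>P ^ 2\<close> at most. Equal
  types are soluble because \<open>-1\<close> is a cube, so the two terms cancel. A vector with a
  zero coefficient is soluble at a coordinate point, so the insoluble set is exactly a finite
  disjoint union of type events, with no null set to discard. A p-adic number is a sequence of
  integer representatives, the one at index \<open>m\<close> being correct modulo
  \<open>P ^ m\<close>; sums and products are then pointwise.\<close>

definition padic :: "int \<Rightarrow> (nat \<Rightarrow> int) \<Rightarrow> bool" where
  "padic P x \<longleftrightarrow> (\<forall>m. [x (Suc m) = x m] (mod P ^ m))"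

text \<open>\<open>lead P x v L\<close>: the valuation of \<open>x\<close> is \<open>v\<close>, and \<open>L\<close> is its unit part modulo \<open>P\<^sup>2\<close>, enough
  to recognise cubes even for \<open>P = 3\<close>.\<close>

definition lead :: "int \<Rightarrow> (nat \<Rightarrow> int) \<Rightarrow> nat \<Rightarrow> int \<Rightarrow> bool" where
  "lead P x v L \<longleftrightarrow> \<not> P dvd L \<and> [x (v + 2) = P ^ v * L] (mod P ^ (v + 2))"

lemma padic_cong:
  assumes "padic P x" "m \<le> m'"
  shows "[x m' = x m] (mod P ^ m)"
  using assms(2)
proof (induction m' rule: dec_induct)
  case (step k)
  have "[x (Suc k) = x k] (mod P ^ k)" using assms(1) by (simp add: padic_def)
  then have "[x (Suc k) = x k] (mod P ^ m)"
    using step.hyps by (meson cong_dvd_modulus le_imp_power_dvd)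
  then show ?case using step.IH cong_trans by blast
qed simp

lemma padic_zp_trunc: "padic (int p) (zp_trunc p d)"
  by (simp add: padic_def zp_trunc_def cong_def)

lemma padic_sum: "(\<And>j. j \<in> J \<Longrightarrow> padic P (x j)) \<Longrightarrow> padic P (\<lambda>m. \<Sum>j\<in>J. x j m)"
  unfolding padic_def by (intro allI cong_sum) auto

lemma padic_mult_const: "padic P x \<Longrightarrow> padic P (\<lambda>m. x m * c)"
  unfolding padic_def by (intro allI cong_mult) auto

lemma padic_const: "padic P (\<lambda>m. c)"
  unfolding padic_def by simp

lemma padic_digits:
  assumes "p > 0" "padic (int p) x"
  obtains d where "\<And>j. d j < p" "\<And>m. [zp_trunc p d m = x m] (mod int p ^ m)"
proof -
  \<comment> \<open>Digit \<open>j\<close> is read at index \<open>Suc j\<close>, the first index at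
    which \<open>x\<close> is correct modulo \<open>p ^ (j + 1)\<close>.\<close>
  define d where "d j = nat (x (Suc j) div int p ^ j mod int p)" for j
  have "d j < p" for j using assms(1) by (simp add: d_def nat_less_iff)
  moreover have "zp_trunc p d m = x m mod int p ^ m" for m
  proof (induction m)
    case 0 show ?case by (simp add: zp_trunc_def)
  next
    case (Suc m)
    have "x (Suc m) mod int p ^ Suc m
        = int p ^ m * (x (Suc m) div int p ^ m mod int p) + x (Suc m) mod int p ^ m"
      using assms(1)
      by (simp add: mult.commute[of "int p"] zmod_zmult2_eq)
    also have "x (Suc m) mod int p ^ m = x m mod int p ^ m"
      using assms(2) by (simp add: padic_def cong_def)
    also have "\<dots> = zp_trunc p d m" using Suc by simp
    finally show ?case using assms(1) by (simp add: zp_trunc_def d_def)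
  qed
  ultimately show thesis by (intro that[of d]) (simp_all add: cong_def)
qed

lemma lead_cong:
  assumes "padic P x" "lead P x v L" "v + 2 \<le> m"
  shows "[x m = P ^ v * L] (mod P ^ (v + 2))"
  using padic_cong[OF assms(1,3)] assms(2) cong_trans unfolding lead_def by blast

lemma lead_decompose:
  assumes "padic P x" "lead P x v L" "v + 2 \<le> m"
  obtains k where "x m = P ^ v * (L + P ^ 2 * k)"
proof -
  from lead_cong[OF assms] obtain k where "x m - P ^ v * L = P ^ (v + 2) * k"
    unfolding cong_iff_dvd_diff dvd_def by blast
  then have "x m = P ^ v * (L + P ^ 2 * k)"
    by (simp add: algebra_simps power_add power2_eq_square)
  then show thesis by (rule that)
qed

lemma lead_exists:
  assumes "prime P" "padic P x" "\<not> P ^ m dvd x m"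
  obtains v L where "lead P x v L" "0 \<le> L" "L < P ^ 2"
proof -
  have P: "P > 0" using assms(1) by (simp add: prime_gt_0_int)
  \<comment> \<open>The least failing exponent is the valuation plus one; exponent \<open>0\<close>
    never fails.\<close>
  define k where "k = (LEAST m. \<not> P ^ m dvd x m)"
  have k: "\<not> P ^ k dvd x k" unfolding k_def by (rule LeastI[of _ m]) (rule assms(3))
  have below: "P ^ j dvd x j" if "j < k" for j
    using not_less_Least[of j "\<lambda>m. \<not> P ^ m dvd x m"] that unfolding k_def by blast
  have "k \<noteq> 0" using k by (intro notI) simp
  then obtain v where v: "k = Suc v" using not0_implies_Suc by blast
  have "P ^ v dvd x (v + 2)"
    using below[of v] padic_cong[OF assms(2), of v "v + 2"] v by (simp add: cong_dvd_iff)
  then obtain g where g: "x (v + 2) = P ^ v * g" by blast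
  have "\<not> P ^ Suc v dvd x (v + 2)"
    using k padic_cong[OF assms(2), of "Suc v" "v + 2"] v by (simp add: cong_dvd_iff)
  then have gP: "\<not> P dvd g" unfolding g using P by simp
  define L where "L = g mod P ^ 2"
  have "[g = L] (mod P ^ 2)" by (simp add: L_def)
  then have "[x (v + 2) = P ^ v * L] (mod P ^ (v + 2))"
    unfolding g cong_iff_dvd_diff power_add right_diff_distrib[symmetric] by (rule mult_dvd_mono[OF dvd_refl])
  moreover have "\<not> P dvd L"
    using gP unfolding L_def by (simp add: dvd_mod_iff)
  ultimately have "lead P x v L" by (simp add: lead_def)
  then show thesis using P by (intro that[of v L]) (auto simp: L_def)
qed

lemma lead_imp_nonzero:
  assumes "lead P x v L" "prime P"
  shows "\<not> P ^ (v + 2) dvd x (v + 2)"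
proof
  assume "P ^ (v + 2) dvd x (v + 2)"
  then have "P ^ (v + 2) dvd P ^ v * L"
    using assms(1) unfolding lead_def using cong_dvd_iff by blast
  then have "P ^ v * P ^ 2 dvd P ^ v * L" by (simp only: power_add)
  then have "P ^ 2 dvd L" using assms(2) by simp
  then have "P dvd L" by (simp add: power2_eq_square dvd_mult_left)
  then show False using assms(1) by (simp add: lead_def)
qed

text \<open>A larger valuation on one side would make \<open>P\<close> divide the unit part on the
  other. Once the valuations agree, cancelling \<open>P ^ v\<close> leaves the unit parts modulo
  \<open>P ^ 2\<close>.\<close>

lemma lead_unique:
  assumes "prime P" "padic P x" "lead P x v L" "lead P x w M"
  shows "v = w \<and> [L = M] (mod P ^ 2)"
proof -
  have less: False if "v < w" and v: "lead P x v L" and w: "lead P x w M" for v w L M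
  proof -
    obtain k where k: "x (v + 2) = P ^ v * (L + P ^ 2 * k)"
      using lead_decompose[OF assms(2) v, of "v + 2"] by auto
    obtain l where l: "x (w + 2) = P ^ w * (M + P ^ 2 * l)"
      using lead_decompose[OF assms(2) w, of "w + 2"] by auto
    have "[x (w + 2) = x (v + 2)] (mod P ^ (Suc v))"
    proof (rule cong_dvd_modulus)
      show "[x (w + 2) = x (v + 2)] (mod P ^ (v + 2))"
        using \<open>v < w\<close> by (intro padic_cong[OF assms(2)]) simp
    qed (simp add: le_imp_power_dvd)
    moreover have "P ^ Suc v dvd x (w + 2)" unfolding l using \<open>v < w\<close>
      by (meson Suc_leI dvd_mult2 le_imp_power_dvd)
    ultimately have "P ^ Suc v dvd x (v + 2)" by (simp add: cong_dvd_iff)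
    then have "P dvd L + P ^ 2 * k" unfolding k using assms(1) by simp
    then have "P dvd L" by (simp add: dvd_add_left_iff power2_eq_square)
    then show False using v by (simp add: lead_def)
  qed
  have vw: "v = w" using less[OF _ assms(3,4)] less[OF _ assms(4,3)] by (meson nat_neq_iff)
  have "[P ^ v * L = P ^ v * M] (mod P ^ (v + 2))"
    using assms(3,4) unfolding vw lead_def by (meson cong_sym cong_trans)
  then have "P ^ v * P ^ 2 dvd P ^ v * (L - M)"
    unfolding cong_iff_dvd_diff power_add right_diff_distrib .
  then have "[L = M] (mod P ^ 2)" using assms(1) unfolding cong_iff_dvd_diff by simp
  with vw show ?thesis by simp
qed

lemma cube_shift: "(y + t * q) ^ 3 = y ^ 3 + 3 * (y ^ 2 * t * q) + 3 * (y * t ^ 2 * q ^ 2) + t ^ 3 * q ^ 3"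
  for y t q :: int
  by (simp add: power2_eq_square power3_eq_cube algebra_simps)

text \<open>The linear term of the expansion is \<open>P ^ (v + e + s)\<close> times a unit times
  \<open>t\<close>, so \<open>t\<close> solves a linear congruence modulo \<open>P\<close>. The
  quadratic term gains another \<open>P ^ s\<close>, and \<open>v + 3 * s\<close> is at least
  \<open>v + e + s + 1\<close> because \<open>e \<le> 1 \<le> s\<close>.\<close>

lemma hensel_cube_step:
  fixes P c a C y l :: int
  assumes P: "prime P" and three: "3 = c * P ^ e" "\<not> P dvd c" "e \<le> 1"
    and a: "a = P ^ v * l" "\<not> P dvd l" and y: "\<not> P dvd y"
    and M: "P ^ (v + e + s) dvd a * y ^ 3 + C" and s: "s \<ge> 1"
  obtains t where "P ^ Suc (v + e + s) dvd a * (y + t * P ^ s) ^ 3 + C"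
proof -
  from M obtain g where g: "a * y ^ 3 + C = P ^ (v + e + s) * g" by blast
  have "coprime (l * y ^ 2 * c) P"
    using P a(2) y three(2) by (simp add: coprime_commute prime_imp_coprime)
  then obtain t0 where "[l * y ^ 2 * c * t0 = 1] (mod P)"
    using cong_solve_coprime_int by blast
  then have "[l * y ^ 2 * c * t0 * (- g) = 1 * (- g)] (mod P)" by (rule cong_scalar_right)
  then have t: "P dvd g + l * y ^ 2 * c * (t0 * (- g))"
    by (simp add: cong_iff_dvd_diff algebra_simps)
  define t where "t = t0 * (- g)"
  have "a * (y + t * P ^ s) ^ 3 + C = P ^ (v + e + s) * (g + l * y ^ 2 * c * t)
     + P ^ (v + e + s) * P ^ s * (c * l * y * t ^ 2) + P ^ (v + 3 * s) * (l * t ^ 3)"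
  proof -
    have "a * (y + t * P ^ s) ^ 3 + C = (a * y ^ 3 + C)
       + a * (3 * (y ^ 2 * t * P ^ s) + 3 * (y * t ^ 2 * (P ^ s) ^ 2) + t ^ 3 * (P ^ s) ^ 3)"
      unfolding cube_shift by (simp add: algebra_simps)
    also have "\<dots> = P ^ (v + e + s) * g
       + P ^ v * l * (c * P ^ e * (y ^ 2 * t * P ^ s) + c * P ^ e * (y * t ^ 2 * (P ^ s) ^ 2) + t ^ 3 * (P ^ s) ^ 3)"
      unfolding g three(1)[symmetric] by (simp add: a(1))
    also have "\<dots> = P ^ (v + e + s) * (g + l * y ^ 2 * c * t)
     + P ^ (v + e + s) * P ^ s * (c * l * y * t ^ 2) + P ^ v * (P ^ s) ^ 3 * (l * t ^ 3)"
      by (simp add: algebra_simps power_add power2_eq_square)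
    also have "P ^ v * (P ^ s) ^ 3 = P ^ (v + 3 * s)"
      by (simp add: power_add power_mult mult.commute)
    finally show ?thesis .
  qed
  moreover have "P ^ Suc (v + e + s) dvd P ^ (v + e + s) * (g + l * y ^ 2 * c * t)"
    using mult_dvd_mono[OF dvd_refl[of "P ^ (v + e + s)"] t] by (simp add: t_def mult.commute)
  moreover have "P ^ Suc (v + e + s) dvd P ^ (v + e + s) * P ^ s * (c * l * y * t ^ 2)"
    unfolding power_add[symmetric] using s by (intro dvd_mult2 le_imp_power_dvd) simp
  moreover have "P ^ Suc (v + e + s) dvd P ^ (v + 3 * s) * (l * t ^ 3)"
    using s three(3) by (intro dvd_mult2 le_imp_power_dvd) simp
  ultimately show thesis by (intro that[of t]) (simp only: dvd_add)
qed

text \<open>\<open>C\<close> collects the terms that are kept fixed while one unit coordinate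
  absorbs the error. That \<open>Y\<close> is again a unit is what later makes the solution
  nonzero.\<close>

lemma hensel_cube:
  fixes P c y :: int
  assumes P: "prime P" and three: "3 = c * P ^ e" "\<not> P dvd c" "e \<le> 1"
    and A: "padic P A" "lead P A v L" and C: "padic P C" and y: "\<not> P dvd y"
    and M: "[A (v + e + 1) * y ^ 3 + C (v + e + 1) = 0] (mod P ^ (v + e + 1))"
  obtains Y where "padic P Y" "\<not> P dvd Y 1" "\<And>m. [A m * Y m ^ 3 + C m = 0] (mod P ^ m)"
proof -
  \<comment> \<open>Stage \<open>n\<close> solves the equation to precision
    \<open>v + e + n + 1\<close> but moves the root only by a multiple of
    \<open>P ^ (n + 1)\<close>, so the roots form a coherent sequence.\<close>
  define Q where "Q n z \<longleftrightarrow> \<not> P dvd z \<and>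
      P ^ (v + e + Suc n) dvd A (v + e + Suc n) * z ^ 3 + C (v + e + Suc n)" for n z
  have "\<exists>f. \<forall>n. Q n (f n) \<and> P ^ Suc n dvd f (Suc n) - f n"
  proof (rule dependent_nat_choice[of Q "\<lambda>n x y. P ^ Suc n dvd y - x"])
    show "\<exists>z. Q 0 z" using y M by (auto simp: Q_def cong_0_iff)
  next
    fix z n assume Q: "Q n z"
    let ?M = "v + e + Suc n"
    have "[A (Suc ?M) * z ^ 3 + C (Suc ?M) = A ?M * z ^ 3 + C ?M] (mod P ^ ?M)"
      by (intro cong_add cong_mult cong_refl padic_cong A C) auto
    then have d: "P ^ ?M dvd A (Suc ?M) * z ^ 3 + C (Suc ?M)"
      using Q by (simp add: cong_dvd_iff Q_def)
    obtain k where k: "A (Suc ?M) = P ^ v * (L + P ^ 2 * k)"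
      using lead_decompose[OF A, of "Suc ?M"] by auto
    have "\<not> P dvd L + P ^ 2 * k"
      using A(2) by (simp add: lead_def dvd_add_left_iff power2_eq_square)
    then obtain t where t: "P ^ Suc ?M dvd A (Suc ?M) * (z + t * P ^ Suc n) ^ 3 + C (Suc ?M)"
      using hensel_cube_step[OF P three k _ _ d] Q by (auto simp: Q_def)
    have "\<not> P dvd z + t * P ^ Suc n"
      using Q by (simp add: Q_def dvd_add_left_iff)
    with t have "Q (Suc n) (z + t * P ^ Suc n)" by (simp add: Q_def)
    then show "\<exists>z'. Q (Suc n) z' \<and> P ^ Suc n dvd z' - z"
      by (intro exI[of _ "z + t * P ^ Suc n"]) simp
  qed
  then obtain Y where Y: "\<And>n. Q n (Y n)" "\<And>n. P ^ Suc n dvd Y (Suc n) - Y n" by blast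
  have "padic P Y"
    unfolding padic_def cong_iff_dvd_diff using Y(2) by (metis dvd_mult_right power_Suc)
  moreover have "\<not> P dvd Y 1" using Y(1)[of 1] by (simp add: Q_def)
  moreover have "[A m * Y m ^ 3 + C m = 0] (mod P ^ m)" for m
  proof -
    have "[A (v + e + Suc m) * Y m ^ 3 + C (v + e + Suc m) = A m * Y m ^ 3 + C m] (mod P ^ m)"
      by (intro cong_add cong_mult cong_refl padic_cong A C) auto
    moreover have "P ^ m dvd A (v + e + Suc m) * Y m ^ 3 + C (v + e + Suc m)"
    proof (rule dvd_trans)
      show "P ^ m dvd P ^ (v + e + Suc m)" by (rule le_imp_power_dvd) simp
      show "P ^ (v + e + Suc m) dvd A (v + e + Suc m) * Y m ^ 3 + C (v + e + Suc m)"
        using Y(1)[of m] by (simp only: Q_def)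
    qed
    ultimately show ?thesis unfolding cong_0_iff using cong_dvd_iff by blast
  qed
  ultimately show thesis by (rule that)
qed

section \<open>Reduction to the leading terms\<close>

text \<open>Solutions can now be built by arithmetic on arbitrary integer representatives, without
  carries between digits.\<close>

lemma diag_Qp_point_iff_padic:
  assumes "p > 0"
  shows "diag_Qp_point p n k a \<longleftrightarrow>
    (\<exists>X. (\<forall>i. padic (int p) (X i)) \<and> (\<exists>i\<le>n. \<exists>m. \<not> int p ^ m dvd X i m) \<and>
       (\<forall>m. int p ^ m dvd (\<Sum>i\<le>n. zp_trunc p (\<lambda>j. a (i, j)) m * X i m ^ k)))"
    (is "?L \<longleftrightarrow> ?R")
proof
  assume ?L
  then obtain x where x: "\<And>i j. x (i, j) < p" "\<exists>i\<le>n. \<exists>j. x (i, j) \<noteq> 0"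
    "\<And>m. [(\<Sum>i\<le>n. zp_trunc p (\<lambda>j. a (i, j)) m * zp_trunc p (\<lambda>j. x (i, j)) m ^ k) = 0] (mod (int p ^ m))"
    unfolding diag_Qp_point_def by blast
  from x(2) obtain i j where ij: "i \<le> n" "x (i, j) \<noteq> 0" by blast
  \<comment> \<open>The truncation just past the lowest nonzero digit is that digit times
    \<open>p ^ j0\<close>, hence nonzero modulo \<open>p ^ Suc j0\<close>.\<close>
  define j0 where "j0 = (LEAST j. x (i, j) \<noteq> 0)"
  have j0: "x (i, j0) \<noteq> 0" unfolding j0_def using ij(2) by (rule LeastI)
  have "x (i, l) = 0" if "l < j0" for l
    using not_less_Least[of l "\<lambda>j. x (i, j) \<noteq> 0"] that unfolding j0_def by blast
  then have "zp_trunc p (\<lambda>j. x (i, j)) (Suc j0) = int (x (i, j0)) * int p ^ j0"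
    by (simp add: zp_trunc_def)
  moreover have "\<not> int p dvd int (x (i, j0))"
    using j0 x(1)[of i j0] by (auto dest: nat_dvd_not_less)
  ultimately have "\<not> int p ^ Suc j0 dvd zp_trunc p (\<lambda>j. x (i, j)) (Suc j0)"
    using assms by simp
  then have "\<exists>i\<le>n. \<exists>m. \<not> int p ^ m dvd zp_trunc p (\<lambda>j. x (i, j)) m" using ij(1) by blast
  then show ?R
    using x(3) by (intro exI[of _ "\<lambda>i. zp_trunc p (\<lambda>j. x (i, j))"]) (simp add: padic_zp_trunc cong_0_iff)
next
  assume ?R
  then obtain X where X: "\<And>i. padic (int p) (X i)" "\<exists>i\<le>n. \<exists>m. \<not> int p ^ m dvd X i m"
    "\<And>m. int p ^ m dvd (\<Sum>i\<le>n. zp_trunc p (\<lambda>j. a (i, j)) m * X i m ^ k)" by blast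
  have "\<forall>i. \<exists>d. (\<forall>j. d j < p) \<and> (\<forall>m. [zp_trunc p d m = X i m] (mod int p ^ m))"
  proof
    fix i
    show "\<exists>d. (\<forall>j. d j < p) \<and> (\<forall>m. [zp_trunc p d m = X i m] (mod int p ^ m))"
      by (rule padic_digits[OF assms X(1)[of i]]) (intro exI conjI allI)
  qed
  then obtain d where d: "\<And>i j. d i j < p" "\<And>i m. [zp_trunc p (d i) m = X i m] (mod int p ^ m)"
    by metis
  define x where "x = (\<lambda>(i, j). d i j)"
  from X(2) obtain i m where i: "i \<le> n" and "\<not> int p ^ m dvd X i m" by blast
  then have "\<not> int p ^ m dvd zp_trunc p (d i) m" using d(2)[of i m] cong_dvd_iff by blast
  then have "zp_trunc p (d i) m \<noteq> 0" by auto
  then have "\<exists>j. d i j \<noteq> 0" by (rule contrapos_np) (simp add: zp_trunc_def)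
  moreover have "[(\<Sum>i\<le>n. zp_trunc p (\<lambda>j. a (i, j)) m * zp_trunc p (d i) m ^ k) = 0] (mod (int p ^ m))" for m
  proof -
    have "[(\<Sum>i\<le>n. zp_trunc p (\<lambda>j. a (i, j)) m * zp_trunc p (d i) m ^ k)
       = (\<Sum>i\<le>n. zp_trunc p (\<lambda>j. a (i, j)) m * X i m ^ k)] (mod (int p ^ m))"
      by (intro cong_sum cong_mult cong_pow cong_refl d)
    then show ?thesis using X(3)[of m] unfolding cong_0_iff using cong_dvd_iff by blast
  qed
  ultimately show ?L
    unfolding diag_Qp_point_def using d(1) i by (intro exI[of _ x]) (auto simp: x_def)
qed

text \<open>The exponents \<open>s j\<close> are the valuations of the terms of a solution, and \<open>i\<close> is a term of minimal
  valuation; the modulus \<open>P ^ (e + 1)\<close> is \<open>9\<close> for \<open>P = 3\<close> and \<open>P\<close> otherwise.\<close>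

definition reduced_zero :: "int \<Rightarrow> nat \<Rightarrow> nat \<Rightarrow> (nat \<Rightarrow> nat) \<Rightarrow> (nat \<Rightarrow> int) \<Rightarrow> bool" where
  "reduced_zero P e n r L \<longleftrightarrow> (\<exists>J i s y. J \<subseteq> {..n} \<and> i \<in> J \<and>
     (\<forall>j\<in>J. s j mod 3 = r j mod 3 \<and> s i \<le> s j \<and> \<not> P dvd y j) \<and>
     P ^ (e + 1) dvd (\<Sum>j\<in>J. P ^ (s j - s i) * L j * y j ^ 3))"

text \<open>The coordinate point with \<open>1\<close> at \<open>i\<close> is a solution. Hence
  every insoluble vector has only nonzero coefficients, each with a valuation and a unit
  part.\<close>

lemma diag_Qp_point_if_zero_coeff:
  assumes "prime p" "i \<le> n" "k > 0" "\<And>m. int p ^ m dvd zp_trunc p (\<lambda>j. a (i, j)) m"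
  shows "diag_Qp_point p n k a"
proof -
  have p: "p > 1" using assms(1) by (rule prime_gt_1_nat)
  define X :: "nat \<Rightarrow> nat \<Rightarrow> int" where "X l m = (if l = i then 1 else 0)" for l m
  have "padic (int p) (X l)" for l by (simp add: padic_def X_def)
  moreover have "\<not> int p ^ 1 dvd X i 1" using p by (simp add: X_def)
  moreover have "int p ^ m dvd (\<Sum>l\<le>n. zp_trunc p (\<lambda>j. a (l, j)) m * X l m ^ k)" for m
    using assms(2,3,4) by (intro dvd_sum) (auto simp: X_def power_0_left)
  ultimately show ?thesis
    unfolding diag_Qp_point_iff_padic[OF prime_gt_0_nat[OF assms(1)]] using assms(2)
    by (intro exI[of _ X] conjI allI exI[of _ i] exI[of _ "1"])
qed

lemma mod3_eq_imp_offset: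
  fixes a b :: nat
  assumes "b \<le> a" "a mod 3 = b mod 3"
  shows "\<exists>q. a = b + 3 * q"
proof -
  have "3 dvd a - b" using assms by (simp add: mod_eq_dvd_iff_nat)
  then obtain q where "a - b = 3 * q" by blast
  then show ?thesis using assms(1) by (intro exI[of _ q]) linarith
qed

text \<open>The exponents \<open>s j\<close> match the valuations only modulo 3 and may lie below
  \<open>v j\<close>. Adding a common \<open>3 * N\<close> multiplies the equation by a cube and
  makes every exponent attainable by \<open>p ^ q j * y j\<close>. All coordinates but
  \<open>i\<close> are then frozen, and Hensel's lemma corrects the \<open>i\<close>-th.\<close>

lemma reduced_zero_imp_diag_Qp_point:
  fixes c :: int
  assumes P: "prime p" and three: "3 = c * int p ^ e" "\<not> int p dvd c" "e \<le> 1"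
    and ld: "\<And>i. i \<le> n \<Longrightarrow> lead (int p) (zp_trunc p (\<lambda>j. a (i, j))) (v i) (L i)"
    and rz: "reduced_zero (int p) e n v L"
  shows "diag_Qp_point p n 3 a"
proof -
  define A where "A i = zp_trunc p (\<lambda>j. a (i, j))" for i
  have A: "padic (int p) (A i)" for i by (simp add: A_def padic_zp_trunc)
  have prime: "prime (int p)" using P by simp
  obtain J i s y where J: "J \<subseteq> {..n}" and i: "i \<in> J"
    and s: "\<And>j. j \<in> J \<Longrightarrow> s j mod 3 = v j mod 3" "\<And>j. j \<in> J \<Longrightarrow> s i \<le> s j"
    and y: "\<And>j. j \<in> J \<Longrightarrow> \<not> int p dvd y j"
    and d: "int p ^ (e + 1) dvd (\<Sum>j\<in>J. int p ^ (s j - s i) * L j * y j ^ 3)"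
    using rz unfolding reduced_zero_def by blast
  have fin: "finite J" using J finite_subset by blast
  define N where "N = (\<Sum>j\<in>J. v j)"
  have vN: "v j \<le> N" if "j \<in> J" for j
    unfolding N_def using fin that by (meson member_le_sum zero_le)
  have "\<forall>j\<in>J. \<exists>q. s j + 3 * N = v j + 3 * q"
  proof
    fix j assume j: "j \<in> J"
    have "v j \<le> s j + 3 * N" using vN[OF j] by linarith
    moreover have "(s j + 3 * N) mod 3 = v j mod 3" using s(1)[OF j] by simp
    ultimately show "\<exists>q. s j + 3 * N = v j + 3 * q" by (intro mod3_eq_imp_offset)
  qed
  then obtain q where q: "\<And>j. j \<in> J \<Longrightarrow> s j + 3 * N = v j + 3 * q j" by metis
  \<comment> \<open>The smallest valuation among the shifted terms; the reduced sum is the equation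
    divided by \<open>p ^ V\<close>.\<close>
  define V where "V = s i + 3 * N"
  define z where "z j = int p ^ q j * y j" for j
  have summand: "[A j m * z j ^ 3 = int p ^ V * (int p ^ (s j - s i) * L j * y j ^ 3)] (mod int p ^ (V + e + 1))"
    if j: "j \<in> J" and m: "v j + 2 \<le> m" for j m
  proof -
    have "j \<le> n" using J j by auto
    then obtain k where k: "A j m = int p ^ v j * (L j + int p ^ 2 * k)"
      using lead_decompose[OF A ld[unfolded A_def[symmetric]] m] by blast
    have eq: "v j + 3 * q j = V + (s j - s i)" using q[OF j] s(2)[OF j] by (simp add: V_def)
    have "A j m * z j ^ 3 = int p ^ (v j + 3 * q j) * (L j + int p ^ 2 * k) * y j ^ 3"
      unfolding k z_def power_mult_distrib power_mult[symmetric] power_add by (simp add: mult.commute)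
    also have "\<dots> = int p ^ V * (int p ^ (s j - s i) * L j * y j ^ 3)
        + int p ^ (V + 2) * (int p ^ (s j - s i) * k * y j ^ 3)"
      unfolding eq power_add by (simp add: algebra_simps)
    finally have "A j m * z j ^ 3 - int p ^ V * (int p ^ (s j - s i) * L j * y j ^ 3)
        = int p ^ (V + 2) * (int p ^ (s j - s i) * k * y j ^ 3)" by simp
    also have "int p ^ (V + e + 1) dvd \<dots>"
      using three(3) by (intro dvd_mult2 le_imp_power_dvd) simp
    finally show ?thesis unfolding cong_iff_dvd_diff .
  qed
  \<comment> \<open>The power \<open>p ^ q i\<close> moves into the coefficient, which then has
    valuation \<open>V\<close>, so that the unknown left for Hensel's lemma is a unit.\<close>
  define A' where "A' m = A i m * (int p ^ q i) ^ 3" for m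
  define C where "C m = (\<Sum>j\<in>J - {i}. A j m * z j ^ 3)" for m
  have A': "padic (int p) A'" unfolding A'_def by (intro padic_mult_const A)
  have C: "padic (int p) C" unfolding C_def by (intro padic_sum padic_mult_const A)
  have Vi: "V = v i + 3 * q i" using q[OF i] by (simp add: V_def)
  have "i \<le> n" using i J by auto
  have ldA': "lead (int p) A' V (L i)"
  proof -
    obtain k where k: "A i (V + 2) = int p ^ v i * (L i + int p ^ 2 * k)"
      using lead_decompose[OF A ld[unfolded A_def[symmetric], OF \<open>i \<le> n\<close>], of "V + 2"] Vi by auto
    have "A' (V + 2) = int p ^ V * L i + int p ^ (V + 2) * k"
      unfolding A'_def k unfolding Vi power_mult[symmetric] power_add by (simp add: algebra_simps)
    then show ?thesis using ld[OF \<open>i \<le> n\<close>] by (simp add: lead_def cong_iff_dvd_diff)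
  qed
  have tot: "A' m * y i ^ 3 + C m = (\<Sum>j\<in>J. A j m * z j ^ 3)" for m
    unfolding C_def A'_def sum.remove[OF fin i] by (simp add: z_def power_mult_distrib)
  \<comment> \<open>An index at which all leading forms are visible; coherence brings the congruence
    back to index \<open>V + e + 1\<close>.\<close>
  define M where "M = (V + e + 1) + (\<Sum>j\<in>J. v j + 2)"
  have vM: "v j + 2 \<le> M" if "j \<in> J" for j
    using member_le_sum[of j J "\<lambda>j. v j + 2"] fin that unfolding M_def by auto
  have "[(\<Sum>j\<in>J. A j M * z j ^ 3) = (\<Sum>j\<in>J. int p ^ V * (int p ^ (s j - s i) * L j * y j ^ 3))] (mod int p ^ (V + e + 1))"
    by (intro cong_sum summand vM)
  moreover have "int p ^ (V + e + 1) dvd (\<Sum>j\<in>J. int p ^ V * (int p ^ (s j - s i) * L j * y j ^ 3))"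
    unfolding sum_distrib_left[symmetric] add.assoc power_add[of _ V] by (intro mult_dvd_mono d dvd_refl)
  ultimately have "int p ^ (V + e + 1) dvd A' M * y i ^ 3 + C M"
    unfolding tot using cong_dvd_iff by blast
  moreover have "[A' M * y i ^ 3 + C M = A' (V + e + 1) * y i ^ 3 + C (V + e + 1)] (mod int p ^ (V + e + 1))"
    by (intro cong_add cong_mult cong_refl padic_cong A' C) (auto simp: M_def)
  ultimately have "[A' (V + e + 1) * y i ^ 3 + C (V + e + 1) = 0] (mod int p ^ (V + e + 1))"
    unfolding cong_0_iff using cong_dvd_iff by blast
  from hensel_cube[OF prime three A' ldA' C y[OF i] this]
  obtain Y where Y: "padic (int p) Y" "\<not> int p dvd Y 1" "\<And>m. [A' m * Y m ^ 3 + C m = 0] (mod int p ^ m)"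
    by blast
  define X where "X j = (if j = i then (\<lambda>m. Y m * int p ^ q i) else if j \<in> J then (\<lambda>_. z j) else (\<lambda>_. 0))" for j
  have "padic (int p) (X j)" for j
    unfolding X_def using Y(1) by (auto intro: padic_mult_const padic_const)
  moreover have "\<not> int p ^ (Suc (q i)) dvd X i (Suc (q i))"
  proof -
    have "[Y (Suc (q i)) = Y 1] (mod int p ^ 1)" by (rule padic_cong[OF Y(1)]) simp
    then have "\<not> int p dvd Y (Suc (q i))" using Y(2) by (simp add: cong_dvd_iff)
    then show ?thesis using P by (simp add: X_def prime_gt_0_nat)
  qed
  moreover have "int p ^ m dvd (\<Sum>j\<le>n. zp_trunc p (\<lambda>l. a (j, l)) m * X j m ^ 3)" for m
  proof -
    have "(\<Sum>j\<le>n. zp_trunc p (\<lambda>l. a (j, l)) m * X j m ^ 3) = (\<Sum>j\<in>J. A j m * X j m ^ 3)"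
      using J i by (intro sum.mono_neutral_cong_right) (auto simp: X_def A_def)
    also have "\<dots> = A' m * Y m ^ 3 + C m"
      unfolding C_def A'_def sum.remove[OF fin i] by (simp add: X_def power_mult_distrib)
    finally show ?thesis using Y(3)[of m] by (simp add: cong_0_iff)
  qed
  ultimately show ?thesis
    unfolding diag_Qp_point_iff_padic[OF prime_gt_0_nat[OF P]] using \<open>i \<le> n\<close>
    by (intro exI[of _ X] conjI allI exI[of _ i] exI[of _ "Suc (q i)"])
qed

text \<open>\<open>J\<close> is the set of nonzero coordinates of a solution and \<open>s j\<close>
  the valuation of its \<open>j\<close>-th term; dividing by the smallest power of \<open>p\<close>
  leaves a sum in which only leading parts enter.\<close>

lemma diag_Qp_point_imp_reduced_zero:
  assumes P: "prime p" and e: "e \<le> 1"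
    and ld: "\<And>i. i \<le> n \<Longrightarrow> lead (int p) (zp_trunc p (\<lambda>j. a (i, j))) (v i) (L i)"
    and dp: "diag_Qp_point p n 3 a"
  shows "reduced_zero (int p) e n v L"
proof -
  define A where "A i = zp_trunc p (\<lambda>j. a (i, j))" for i
  have A: "padic (int p) (A i)" for i by (simp add: A_def padic_zp_trunc)
  have prime: "prime (int p)" using P by simp
  obtain X where X: "\<And>i. padic (int p) (X i)" "\<exists>i\<le>n. \<exists>m. \<not> int p ^ m dvd X i m"
    "\<And>m. int p ^ m dvd (\<Sum>i\<le>n. A i m * X i m ^ 3)"
    using dp P by (subst (asm) diag_Qp_point_iff_padic) (auto simp: prime_gt_0_nat A_def)
  define J where "J = {i. i \<le> n \<and> (\<exists>m. \<not> int p ^ m dvd X i m)}"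
  have fin: "finite J" by (rule finite_subset[of _ "{..n}"]) (auto simp: J_def)
  have "\<forall>j\<in>J. \<exists>k y. lead (int p) (X j) k y"
  proof
    fix j assume "j \<in> J"
    then obtain m where "\<not> int p ^ m dvd X j m" by (auto simp: J_def)
    from lead_exists[OF prime X(1) this] show "\<exists>k y. lead (int p) (X j) k y" by blast
  qed
  then obtain k y where ky: "\<And>j. j \<in> J \<Longrightarrow> lead (int p) (X j) (k j) (y j)" by metis
  define s where "s j = v j + 3 * k j" for j
  have "J \<noteq> {}" using X(2) by (auto simp: J_def)
  then obtain i where i: "i \<in> J" "\<And>j. j \<in> J \<Longrightarrow> s i \<le> s j"
    using fin arg_min_least[of J _ s] arg_min_if_finite(1)[of J s] by blast
  define V where "V = s i"
  define M where "M = (V + 2) + (\<Sum>j\<in>J. v j + k j + 2)"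
  have big: "v j + k j + 2 \<le> M" if "j \<in> J" for j
    using member_le_sum[of j J "\<lambda>j. v j + k j + 2"] fin that unfolding M_def by auto
  have summand: "[A j M * X j M ^ 3 = int p ^ V * (int p ^ (s j - s i) * L j * y j ^ 3)] (mod int p ^ (V + e + 1))"
    if j: "j \<in> J" for j
  proof -
    have "j \<le> n" using j by (simp add: J_def)
    then obtain g where g: "A j M = int p ^ v j * (L j + int p ^ 2 * g)"
      using lead_decompose[OF A ld[unfolded A_def[symmetric]], of j M] big[OF j] by auto
    obtain h where h: "X j M = int p ^ k j * (y j + int p ^ 2 * h)"
      using lead_decompose[OF X(1) ky[OF j], of M] big[OF j] by auto
    have "[(L j + int p ^ 2 * g) * (y j + int p ^ 2 * h) ^ 3 = L j * y j ^ 3] (mod int p ^ 2)"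
      by (intro cong_mult cong_pow) (auto simp: cong_iff_dvd_diff)
    then have "[(L j + int p ^ 2 * g) * (y j + int p ^ 2 * h) ^ 3 = L j * y j ^ 3] (mod int p ^ (e + 1))"
      by (rule cong_dvd_modulus) (rule le_imp_power_dvd, use e in simp)
    then obtain w where w: "(L j + int p ^ 2 * g) * (y j + int p ^ 2 * h) ^ 3 = L j * y j ^ 3 + int p ^ (e + 1) * w"
      by (metis cong_iff_lin cong_sym)
    have eq: "v j + 3 * k j = V + (s j - s i)" using i(2)[OF j] by (simp add: V_def s_def)
    have "A j M * X j M ^ 3 = int p ^ (v j + 3 * k j) * ((L j + int p ^ 2 * g) * (y j + int p ^ 2 * h) ^ 3)"
      unfolding g h power_mult_distrib power_mult[symmetric] power_add by (simp add: mult.commute)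
    also have "\<dots> = int p ^ V * (int p ^ (s j - s i) * L j * y j ^ 3) + int p ^ (V + e + 1) * (int p ^ (s j - s i) * w)"
      unfolding w eq power_add by (simp add: algebra_simps)
    finally show ?thesis by (simp add: cong_iff_dvd_diff)
  qed
  \<comment> \<open>A coordinate outside \<open>J\<close> is the p-adic zero, but its representative
    at index \<open>M\<close> is merely divisible by \<open>p ^ M\<close>.\<close>
  have out: "int p ^ (V + e + 1) dvd A j M * X j M ^ 3" if "j \<in> {..n} - J" for j
  proof -
    have "int p ^ M dvd X j M" using that by (auto simp: J_def)
    then have "int p ^ M dvd A j M * X j M ^ 3" by (simp add: power3_eq_cube)
    then show ?thesis using e by (elim power_le_dvd) (simp add: M_def)
  qed
  have "int p ^ (V + e + 1) dvd (\<Sum>j\<le>n. A j M * X j M ^ 3)"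
    using X(3)[of M] e by (elim power_le_dvd) (simp add: M_def)
  moreover have "(\<Sum>j\<le>n. A j M * X j M ^ 3) = (\<Sum>j\<in>{..n} - J. A j M * X j M ^ 3) + (\<Sum>j\<in>J. A j M * X j M ^ 3)"
    by (rule sum.subset_diff) (auto simp: J_def)
  moreover have "int p ^ (V + e + 1) dvd (\<Sum>j\<in>{..n} - J. A j M * X j M ^ 3)"
    by (intro dvd_sum out)
  ultimately have "int p ^ (V + e + 1) dvd (\<Sum>j\<in>J. A j M * X j M ^ 3)"
    by (simp only: dvd_add_right_iff)
  moreover have "[(\<Sum>j\<in>J. A j M * X j M ^ 3) = (\<Sum>j\<in>J. int p ^ V * (int p ^ (s j - s i) * L j * y j ^ 3))] (mod int p ^ (V + e + 1))"
    by (intro cong_sum summand)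
  ultimately have "int p ^ (V + e + 1) dvd (\<Sum>j\<in>J. int p ^ V * (int p ^ (s j - s i) * L j * y j ^ 3))"
    using cong_dvd_iff by blast
  then have "int p ^ V * int p ^ (e + 1) dvd int p ^ V * (\<Sum>j\<in>J. int p ^ (s j - s i) * L j * y j ^ 3)"
    by (simp only: sum_distrib_left add.assoc power_add)
  then have "int p ^ (e + 1) dvd (\<Sum>j\<in>J. int p ^ (s j - s i) * L j * y j ^ 3)"
    using P by (subst (asm) dvd_mult_cancel_left) (auto simp: prime_gt_0_nat)
  moreover have "J \<subseteq> {..n}" by (auto simp: J_def)
  moreover have "\<forall>j\<in>J. s j mod 3 = v j mod 3 \<and> s i \<le> s j \<and> \<not> int p dvd y j"
    using i(2) ky by (auto simp: s_def lead_def)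
  ultimately show ?thesis
    unfolding reduced_zero_def using i(1)
    by (intro exI[of _ J] exI[of _ i] exI[of _ s] exI[of _ y] conjI)
qed

section \<open>Classes of units modulo cubes\<close>

text \<open>\<open>K\<close> numbers the units modulo \<open>p ^ (e + 1)\<close> up to cubes. The
  instances have \<open>e = 0\<close>, \<open>\<kappa> = 1\<close> for \<open>p\<close> congruent to
  2 modulo 3; \<open>e = 0\<close>, \<open>\<kappa> = 3\<close> for \<open>p\<close> congruent to 1;
  \<open>e = 1\<close>, \<open>\<kappa> = 3\<close> for \<open>p = 3\<close>. \<open>card_K\<close>
  shares the \<open>p * (p - 1)\<close> units modulo \<open>p ^ 2\<close> equally among the classes,
  which is the form the probabilities need.\<close>

locale cube_classes =
  fixes p e \<kappa> :: nat and c :: int and K :: "int \<Rightarrow> nat"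
  assumes prime_p: "prime p"
    and three: "3 = c * int p ^ e" "\<not> int p dvd c" "e \<le> 1"
    and K_eq_iff: "\<lbrakk>\<not> int p dvd u; \<not> int p dvd w\<rbrakk> \<Longrightarrow>
          K u = K w \<longleftrightarrow> (\<exists>y. [u = w * y ^ 3] (mod int p ^ (e + 1)))"
    and K_less: "\<not> int p dvd u \<Longrightarrow> K u < \<kappa>"
    and card_K: "r < \<kappa> \<Longrightarrow> \<kappa> * card {L \<in> {0..<int p ^ 2}. \<not> int p dvd L \<and> K L = r} = p * (p - 1)"
begin

lemma K_cong:
  assumes "[u = w] (mod int p ^ (e + 1))" "\<not> int p dvd u"
  shows "K u = K w"
proof -
  have "[u = w] (mod int p)" using assms(1) by (rule cong_dvd_modulus) simp
  then have "\<not> int p dvd w" using assms(2) by (simp add: cong_dvd_iff)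
  moreover have "[u = w * 1 ^ 3] (mod int p ^ (e + 1))" using assms(1) by simp
  ultimately show ?thesis using K_eq_iff[OF assms(2)] by blast
qed

text \<open>The sign is absorbed into the cube, so equal classes make a sum vanish and not just a
  difference.\<close>

lemma K_eq_imp_cube_sum:
  assumes "\<not> int p dvd u" "\<not> int p dvd w" "K u = K w"
  obtains y where "\<not> int p dvd y" "int p ^ (e + 1) dvd u + w * y ^ 3"
proof -
  obtain y where y: "[u = w * y ^ 3] (mod int p ^ (e + 1))" using K_eq_iff assms by blast
  then have "[u = w * y ^ 3] (mod int p)" by (rule cong_dvd_modulus) simp
  then have "\<not> int p dvd w * y ^ 3" using assms(1) by (simp add: cong_dvd_iff)
  then have "\<not> int p dvd - y" by (auto simp: power3_eq_cube)
  moreover have "int p ^ (e + 1) dvd u + w * (- y) ^ 3"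
    using y by (simp add: cong_iff_dvd_diff)
  ultimately show thesis by (rule that)
qed

lemma cube_sum_imp_K_eq:
  assumes u: "\<not> int p dvd u" "\<not> int p dvd w" and y: "\<not> int p dvd y" "\<not> int p dvd z"
    and d: "int p ^ (e + 1) dvd u * y ^ 3 + w * z ^ 3"
  shows "K u = K w"
proof -
  have "coprime (int p) y" using y(1) prime_p by (intro prime_imp_coprime) auto
  then have "coprime y (int p ^ (e + 1))" by (simp add: coprime_commute)
  then obtain t where t: "[y * t = 1] (mod int p ^ (e + 1))" using cong_solve_coprime_int by blast
  have "[u * (y * t) ^ 3 = u * 1 ^ 3] (mod int p ^ (e + 1))"
    by (intro cong_mult cong_pow t cong_refl)
  then have 1: "[u * (y * t) ^ 3 = u] (mod int p ^ (e + 1))" by simp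
  have "u * (y * t) ^ 3 - w * (- z * t) ^ 3 = (u * y ^ 3 + w * z ^ 3) * t ^ 3"
    by (simp add: power3_eq_cube algebra_simps)
  then have "[u * (y * t) ^ 3 = w * (- z * t) ^ 3] (mod int p ^ (e + 1))"
    unfolding cong_iff_dvd_diff using d by simp
  then have "[u = w * (- z * t) ^ 3] (mod int p ^ (e + 1))"
    using 1 by (meson cong_sym cong_trans)
  then show ?thesis using K_eq_iff u by blast
qed

lemma reduced_zero_if_not_inj:
  assumes L: "\<And>i. i \<le> n \<Longrightarrow> \<not> int p dvd L i"
    and ninj: "\<not> inj_on (\<lambda>i. (v i mod 3, K (L i))) {..n}"
  shows "reduced_zero (int p) e n v L"
proof -
  from ninj obtain i j where ij: "i \<le> n" "j \<le> n" "i \<noteq> j" "v i mod 3 = v j mod 3" "K (L i) = K (L j)"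
    by (auto simp: inj_on_def)
  obtain y where y: "\<not> int p dvd y" "int p ^ (e + 1) dvd L i + L j * y ^ 3"
    using K_eq_imp_cube_sum[OF L L ij(5)] ij(1,2) by blast
  have "\<not> int p dvd 1" using prime_p not_prime_1 by fastforce
  then show ?thesis unfolding reduced_zero_def
    using ij y
    by (intro exI[of _ "{i, j}"] exI[of _ i] exI[of _ "\<lambda>_. v i mod 3"] exI[of _ "\<lambda>l. if l = i then 1 else y"])
       auto
qed

text \<open>Keep the terms with \<open>s j = s i\<close>. All others are divisible by
  \<open>p\<close>, so the kept part vanishes modulo \<open>p\<close>, which a single unit term
  cannot do. An exponent \<open>s i + 1\<close> needs an index at the next level modulo 3; without
  one the other exponents are at least \<open>s i + 2\<close>, which covers
  \<open>e + 1\<close>.\<close>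

lemma reduced_zero_leading_part:
  assumes L: "\<And>i. i \<le> n \<Longrightarrow> \<not> int p dvd L i"
    and rz: "reduced_zero (int p) e n v L"
  obtains J i y where "J \<subseteq> {..n}" "i \<in> J" "\<And>j. j \<in> J \<Longrightarrow> v j mod 3 = v i mod 3"
    "\<And>j. j \<in> J \<Longrightarrow> \<not> int p dvd y j" "J \<noteq> {i}" "int p dvd (\<Sum>j\<in>J. L j * y j ^ 3)"
    "(\<And>l. l \<le> n \<Longrightarrow> v l mod 3 \<noteq> (v i + 1) mod 3) \<Longrightarrow> int p ^ (e + 1) dvd (\<Sum>j\<in>J. L j * y j ^ 3)"
proof -
  obtain J i s y where J: "J \<subseteq> {..n}" and i: "i \<in> J"
    and s: "\<And>j. j \<in> J \<Longrightarrow> s j mod 3 = v j mod 3" "\<And>j. j \<in> J \<Longrightarrow> s i \<le> s j"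
    and y: "\<And>j. j \<in> J \<Longrightarrow> \<not> int p dvd y j"
    and d: "int p ^ (e + 1) dvd (\<Sum>j\<in>J. int p ^ (s j - s i) * L j * y j ^ 3)"
    using rz unfolding reduced_zero_def by blast
  define J0 where "J0 = {j \<in> J. s j = s i}"
  have fin: "finite J" using J finite_subset by blast
  have split: "(\<Sum>j\<in>J. int p ^ (s j - s i) * L j * y j ^ 3)
     = (\<Sum>j\<in>J - J0. int p ^ (s j - s i) * L j * y j ^ 3) + (\<Sum>j\<in>J0. L j * y j ^ 3)"
    by (subst sum.subset_diff[of J0 J]) (auto simp: J0_def fin)
  have part: "int p ^ m dvd (\<Sum>j\<in>J0. L j * y j ^ 3)"
    if "m \<le> e + 1" "\<And>j. j \<in> J - J0 \<Longrightarrow> m \<le> s j - s i" for m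
  proof -
    have "int p ^ m dvd (\<Sum>j\<in>J - J0. int p ^ (s j - s i) * L j * y j ^ 3)"
      using that(2) by (intro dvd_sum dvd_mult2 le_imp_power_dvd) auto
    moreover have "int p ^ m dvd (\<Sum>j\<in>J. int p ^ (s j - s i) * L j * y j ^ 3)"
      using d that(1) power_le_dvd by blast
    ultimately show ?thesis unfolding split by (simp only: dvd_add_right_iff)
  qed
  have "int p ^ 1 dvd (\<Sum>j\<in>J0. L j * y j ^ 3)"
    by (rule part) (use s(2) in \<open>force simp: J0_def\<close>)+
  then have d1: "int p dvd (\<Sum>j\<in>J0. L j * y j ^ 3)" by simp
  show thesis
  proof (rule that[of J0 i y])
    show "J0 \<subseteq> {..n}" "i \<in> J0" using J i by (auto simp: J0_def)
    show "v j mod 3 = v i mod 3" if "j \<in> J0" for j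
      using that s(1)[of j] s(1)[OF i] by (simp add: J0_def)
    show "\<not> int p dvd y j" if "j \<in> J0" for j using that y by (simp add: J0_def)
    show "J0 \<noteq> {i}"
    proof
      assume "J0 = {i}"
      with d1 have "int p dvd L i * y i ^ 3" by simp
      moreover have "prime (int p)" using prime_p by simp
      ultimately have "int p dvd L i \<or> int p dvd y i"
        using prime_dvd_mult_iff prime_dvd_power by blast
      then show False using L[of i] y[OF i] i J by auto
    qed
    show "int p dvd (\<Sum>j\<in>J0. L j * y j ^ 3)" by (rule d1)
    assume no: "\<And>l. l \<le> n \<Longrightarrow> v l mod 3 \<noteq> (v i + 1) mod 3"
    show "int p ^ (e + 1) dvd (\<Sum>j\<in>J0. L j * y j ^ 3)"
    proof (rule part)
      fix j assume j: "j \<in> J - J0"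
      have "s j \<noteq> s i + 1"
      proof
        assume "s j = s i + 1"
        then have "v j mod 3 = (s i + 1) mod 3" using s(1)[of j] j by simp
        also have "\<dots> = (v i + 1) mod 3" using s(1)[OF i] by (metis mod_add_left_eq)
        finally show False using no[of j] j J by auto
      qed
      moreover have "s i \<le> s j" "s j \<noteq> s i" using j s(2) by (auto simp: J0_def)
      ultimately show "e + 1 \<le> s j - s i" using three(3) by linarith
    qed simp
  qed
qed

text \<open>The leading part would consist of exactly two terms, and two terms cancel only if their
  classes agree. With \<open>e = 0\<close>, vanishing modulo \<open>p\<close> is enough for this
  conclusion.\<close>

lemma not_reduced_zero_if_fibres_le_2:
  assumes L: "\<And>i. i \<le> n \<Longrightarrow> \<not> int p dvd L i" and e: "e = 0"
    and inj: "inj_on (\<lambda>i. (v i mod 3, K (L i))) {..n}"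
    and fib: "\<And>i. card {j. j \<le> n \<and> v j mod 3 = v i mod 3} \<le> 2"
  shows "\<not> reduced_zero (int p) e n v L"
proof
  assume rz: "reduced_zero (int p) e n v L"
  obtain J i y where J: "J \<subseteq> {..n}" "i \<in> J" "\<And>j. j \<in> J \<Longrightarrow> v j mod 3 = v i mod 3"
    "\<And>j. j \<in> J \<Longrightarrow> \<not> int p dvd y j" "J \<noteq> {i}" "int p dvd (\<Sum>j\<in>J. L j * y j ^ 3)"
    by (rule reduced_zero_leading_part[OF _ rz]) (rule L, assumption, rule that)
  from J(2,5) obtain j where j: "j \<in> J" "j \<noteq> i" by blast
  have "finite J" using J(1) finite_subset by blast
  have "card J \<le> card {j. j \<le> n \<and> v j mod 3 = v i mod 3}"
    using J(1,3) by (intro card_mono) auto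
  also note fib
  finally have "card J \<le> card {i, j}" using j by simp
  then have "J = {i, j}"
    using card_seteq[OF \<open>finite J\<close>, of "{i, j}"] J(2) j(1) by simp
  then have "int p dvd L i * y i ^ 3 + L j * y j ^ 3" using J(6) j(2) by simp
  then have "K (L i) = K (L j)"
    using cube_sum_imp_K_eq[of "L i" "L j" "y i" "y j"] L J(1,2,4) j(1) e by auto
  then show False using inj_onD[OF inj, of j i] J(1,2) J(3)[OF j(1)] j by auto
qed

end

section \<open>Discrete logarithms and the sizes of the cube classes\<close>

lemma discrete_log_exists:
  assumes "prime p"
  obtains g :: int and l :: "int \<Rightarrow> nat" where "\<not> int p dvd g"
    "\<And>u. \<not> int p dvd u \<Longrightarrow> [u = g ^ l u] (mod int p)"
    "\<And>i j. [g ^ i = g ^ j] (mod int p) \<longleftrightarrow> [i = j] (mod (p - 1))"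
proof -
  have p1: "p > 1" using assms by (rule prime_gt_1_nat)
  obtain h where h: "residue_primroot p h" using prime_primitive_root_exists[OF p1 assms] by blast
  then have cop: "coprime p h" and ord: "ord p h = p - 1"
    using assms by (auto simp: residue_primroot_def totient_prime)
  have eq: "[h ^ i = h ^ j] (mod p) \<longleftrightarrow> [i = j] (mod (p - 1))" for i j
    using order_divides_expdiff[OF cop] ord by simp
  have inj: "inj_on (\<lambda>k. h ^ k mod p) {..<p - 1}"
    using eq by (auto simp: inj_on_def cong_def)
  have "(\<lambda>k. h ^ k mod p) ` {..<p - 1} \<subseteq> {1..<p}"
  proof safe
    fix k
    have "\<not> p dvd h ^ k"
      using cop assms by (metis coprime_power_right_iff coprime_absorb_left not_prime_unit)
    then show "h ^ k mod p \<in> {1..<p}" using p1 by (simp add: Suc_le_eq mod_greater_zero_iff_not_dvd)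
  qed
  \<comment> \<open>The \<open>p - 1\<close> distinct powers of a primitive root fill the
    \<open>p - 1\<close> nonzero residues.\<close>
  then have surj: "(\<lambda>k. h ^ k mod p) ` {..<p - 1} = {1..<p}"
    using card_image[OF inj] by (intro card_subset_eq) auto
  have "\<exists>k. [u = int h ^ k] (mod int p)" if "\<not> int p dvd u" for u
  proof -
    have "u mod int p \<noteq> 0" using that by (simp add: dvd_eq_mod_eq_0)
    moreover have "u mod int p \<ge> 0" using p1 by simp
    ultimately have "u mod int p > 0" by linarith
    then have "nat (u mod int p) \<in> {1..<p}" using p1 by (auto simp: nat_less_iff)
    then obtain k where "h ^ k mod p = nat (u mod int p)" unfolding surj[symmetric] by auto
    then have "int (h ^ k mod p) = u mod int p" using p1 by simp
    then have "[u = int h ^ k] (mod int p)" by (simp add: cong_def zmod_int)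
    then show ?thesis by blast
  qed
  then obtain l where "\<And>u. \<not> int p dvd u \<Longrightarrow> [u = int h ^ l u] (mod int p)" by metis
  moreover have "\<not> int p dvd int h"
    using cop assms by (metis coprime_absorb_left not_prime_unit int_dvd_int_iff)
  moreover have "[int h ^ i = int h ^ j] (mod int p) \<longleftrightarrow> [i = j] (mod (p - 1))" for i j
    using eq[of i j] by (metis cong_int_iff of_nat_power)
  ultimately show thesis by (intro that[of "int h" l]) auto
qed

lemma card_units_mod_square:
  assumes "prime p"
  shows "card {L \<in> {0..<int p ^ 2}. \<not> int p dvd L} = p * (p - 1)"
proof -
  have p: "p > 0" using assms by (rule prime_gt_0_nat)
  have mult: "{L \<in> {0..<int p ^ 2}. int p dvd L} = (\<lambda>k. int p * k) ` {0..<int p}"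
  proof
    show "{L \<in> {0..<int p ^ 2}. int p dvd L} \<subseteq> (\<lambda>k. int p * k) ` {0..<int p}"
      using p by (auto simp: power2_eq_square zero_le_mult_iff)
    show "(\<lambda>k. int p * k) ` {0..<int p} \<subseteq> {L \<in> {0..<int p ^ 2}. int p dvd L}"
      using p by (auto simp: power2_eq_square)
  qed
  have "inj_on (\<lambda>k. int p * k) {0..<int p}" using p by (simp add: inj_on_def)
  then have c: "card {L \<in> {0..<int p ^ 2}. int p dvd L} = p" unfolding mult by (simp add: card_image)
  have "{L \<in> {0..<int p ^ 2}. \<not> int p dvd L} = {0..<int p ^ 2} - {L \<in> {0..<int p ^ 2}. int p dvd L}" by auto
  moreover have "card ({0..<int p ^ 2} - {L \<in> {0..<int p ^ 2}. int p dvd L})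
      = card {0..<int p ^ 2} - card {L \<in> {0..<int p ^ 2}. int p dvd L}"
    by (rule card_Diff_subset) (auto intro: finite_subset[of _ "{0..<int p ^ 2}"])
  ultimately have "card {L \<in> {0..<int p ^ 2}. \<not> int p dvd L} = card {0..<int p ^ 2} - p" using c by simp
  also have "card {0..<int p ^ 2} = p ^ 2" by (simp add: nat_power_eq)
  finally show ?thesis by (simp add: power2_eq_square diff_mult_distrib2)
qed

text \<open>Multiplication by \<open>g\<close> embeds each class in the next; going once round the
  three classes forces equal sizes. The exponent \<open>m\<close> is \<open>2\<close> for the
  probabilities and \<open>1\<close> for counting in the residue field.\<close>

lemma card_fibres_equal:
  fixes K :: "int \<Rightarrow> nat" and g :: int
  assumes "prime p" "m > 0" "\<not> int p dvd g"
    and cong: "\<And>u w. [u = w] (mod int p) \<Longrightarrow> \<not> int p dvd u \<Longrightarrow> K u = K w"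
    and shift: "\<And>u. \<not> int p dvd u \<Longrightarrow> K (g * u) = Suc (K u) mod 3"
    and r: "r < 3"
  shows "card {L \<in> {0..<int p ^ m}. \<not> int p dvd L \<and> K L = r}
       = card {L \<in> {0..<int p ^ m}. \<not> int p dvd L \<and> K L = 0}"
proof -
  define F where "F r = {L \<in> {0..<int p ^ m}. \<not> int p dvd L \<and> K L = r}" for r
  have p: "prime (int p)" "p > 0" using assms(1) by (auto simp: prime_gt_0_nat)
  have cop: "coprime g (int p ^ m)"
    using assms(3) p(1) by (meson coprime_commute coprime_power_right_iff prime_imp_coprime)
  have le: "card (F r) \<le> card (F (Suc r mod 3))" for r
  proof (rule card_inj_on_le)
    show "inj_on (\<lambda>L. g * L mod int p ^ m) (F r)"
    proof (rule inj_onI)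
      fix x y assume xy: "x \<in> F r" "y \<in> F r" "g * x mod int p ^ m = g * y mod int p ^ m"
      then have "[x = y] (mod int p ^ m)"
        using cop by (metis cong_def cong_mult_lcancel)
      then show "x = y" using xy(1,2) by (simp add: F_def cong_def)
    qed
    show "(\<lambda>L. g * L mod int p ^ m) ` F r \<subseteq> F (Suc r mod 3)"
    proof
      fix z assume "z \<in> (\<lambda>L. g * L mod int p ^ m) ` F r"
      then obtain L where L: "L \<in> F r" "z = g * L mod int p ^ m" by blast
      have "[z = g * L] (mod int p ^ m)" by (simp add: L(2))
      then have zc: "[z = g * L] (mod int p)"
        by (rule cong_dvd_modulus) (use assms(2) in simp)
      have "\<not> int p dvd g * L" using L(1) assms(3) p(1) by (simp add: F_def prime_dvd_mult_iff)
      then have nz: "\<not> int p dvd z" using zc by (simp add: cong_dvd_iff)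
      then have "K z = K (g * L)" using zc cong by blast
      then have "K z = Suc r mod 3" using shift[of L] L(1) by (simp add: F_def)
      then show "z \<in> F (Suc r mod 3)" using nz L(2) p(2) by (simp add: F_def)
    qed
    show "finite (F (Suc r mod 3))"
      by (rule finite_subset[of _ "{0..<int p ^ m}"]) (auto simp: F_def)
  qed
  have "card (F 0) \<le> card (F 1)" "card (F 1) \<le> card (F 2)" "card (F 2) \<le> card (F 0)"
    using le[of 0] le[of 1] le[of 2] by (auto simp: numeral_2_eq_2)
  moreover have "r = 0 \<or> r = 1 \<or> r = 2" using r by linarith
  ultimately have "card (F r) = card (F 0)" by auto
  then show ?thesis by (simp add: F_def)
qed

lemma card_fibres_mod_square:
  fixes K :: "int \<Rightarrow> nat"
  assumes "prime p"
    and eq: "\<And>r. r < 3 \<Longrightarrow> card {L \<in> {0..<int p ^ 2}. \<not> int p dvd L \<and> K L = r}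
       = card {L \<in> {0..<int p ^ 2}. \<not> int p dvd L \<and> K L = 0}"
    and less: "\<And>u. \<not> int p dvd u \<Longrightarrow> K u < 3" and r: "r < 3"
  shows "3 * card {L \<in> {0..<int p ^ 2}. \<not> int p dvd L \<and> K L = r} = p * (p - 1)"
proof -
  define F where "F r = {L \<in> {0..<int p ^ 2}. \<not> int p dvd L \<and> K L = r}" for r
  have fin: "finite (F r)" for r
    by (rule finite_subset[of _ "{0..<int p ^ 2}"]) (auto simp: F_def)
  have eqF: "card (F r) = card (F 0)" if "r < 3" for r
    unfolding F_def by (rule eq[OF that])
  have "{L \<in> {0..<int p ^ 2}. \<not> int p dvd L} = (\<Union>r\<in>{..<3}. F r)"
    using less by (auto simp: F_def)
  then have "p * (p - 1) = card (\<Union>r\<in>{..<3}. F r)" using card_units_mod_square[OF assms(1)] by simp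
  also have "\<dots> = (\<Sum>r<3. card (F r))"
  proof (rule card_UN_disjoint)
    show "\<forall>r\<in>{..<3}. finite (F r)" using fin by blast
    show "\<forall>i\<in>{..<3}. \<forall>j\<in>{..<3}. i \<noteq> j \<longrightarrow> F i \<inter> F j = {}" by (auto simp: F_def)
  qed simp
  also have "\<dots> = (\<Sum>r<3::nat. card (F 0))"
    by (rule sum.cong[OF refl], rule eqF, simp)
  finally show ?thesis unfolding F_def[symmetric] eqF[OF r] by simp
qed

text \<open>If no \<open>x\<close> had class 1 with \<open>x + 1\<close> of class 2, then \<open>x \<mapsto> -(x + 1)\<close> or \<open>x \<mapsto> -(1/x + 1)\<close>
  (according to whether \<open>x + 1\<close> has class 0 or 1) would inject the residues of class 1 into those
  of class 0 other than \<open>-1\<close>, although both classes have the same size.\<close>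

lemma consecutive_cube_classes:
  fixes K :: "int \<Rightarrow> nat" and g :: int
  assumes p: "prime p"
    and cong: "\<And>u w. [u = w] (mod int p) \<Longrightarrow> \<not> int p dvd u \<Longrightarrow> K u = K w"
    and mult: "\<And>u w. \<not> int p dvd u \<Longrightarrow> \<not> int p dvd w \<Longrightarrow> K (u * w) = (K u + K w) mod 3"
    and less: "\<And>u. \<not> int p dvd u \<Longrightarrow> K u < 3"
    and g: "\<not> int p dvd g" "K g = 1"
  shows "\<exists>x. \<not> int p dvd x \<and> K x = 1 \<and> \<not> int p dvd x + 1 \<and> K (x + 1) = 2"
proof (rule ccontr)
  assume no: "\<not> ?thesis"
  have P: "prime (int p)" "int p > 1" using p prime_gt_1_nat[OF p] by auto
  have nd1: "\<not> int p dvd 1" using P(2) by simp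
  \<comment> \<open>Applied to \<open>1\<close> and \<open>-1\<close>, whose squares are
    \<open>1\<close>: the class \<open>k\<close> satisfies \<open>k + k = k\<close> or
    \<open>k + k = 0\<close> modulo 3, hence is 0.\<close>
  have double: "k = 0" if "k < 3" "(k + k) mod 3 = k \<or> (k + k) mod 3 = 0" for k :: nat
    using that by presburger
  have K1: "K 1 = 0" using double[OF less[OF nd1]] mult[OF nd1 nd1] by (metis mult_1)
  have Km1: "K (- 1) = 0"
  proof -
    have "\<not> int p dvd - 1" using nd1 by simp
    from double[OF less[OF this]] mult[OF this this] show ?thesis using K1 by simp
  qed
  have Kneg: "K (- u) = K u" if "\<not> int p dvd u" for u
    using mult[of "-1" u] nd1 that Km1 less[of u] by simp
  define F where "F r = {L \<in> {0..<int p ^ 1}. \<not> int p dvd L \<and> K L = r}" for r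
  have fin: "finite (F r)" for r
    by (rule finite_subset[of _ "{0..<int p ^ 1}"]) (auto simp: F_def)
  have FF: "card (F 1) = card (F 0)"
    unfolding F_def using p g mult less cong
    by (intro card_fibres_equal[of p 1 g K]) auto
  have "\<exists>t. [x * t = 1] (mod int p)" if "x \<in> F 1" for x
  proof -
    have "coprime (int p) x" using that P(1) by (intro prime_imp_coprime) (auto simp: F_def)
    then show ?thesis using cong_solve_coprime_int coprime_commute by blast
  qed
  then obtain t where t: "\<And>x. x \<in> F 1 \<Longrightarrow> [x * t x = 1] (mod int p)" by metis
  have tnd: "\<not> int p dvd t x" if "x \<in> F 1" for x
  proof
    assume "int p dvd t x"
    then have "int p dvd x * t x" by simp
    then have "int p dvd 1" using t[OF that] cong_dvd_iff by blast
    then show False using nd1 by simp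
  qed
  have Kt: "K (t x) = 2" if "x \<in> F 1" for x
  proof -
    have nd: "\<not> int p dvd x" "K x = 1" using that by (auto simp: F_def)
    have "K 1 = K (x * t x)" using cong[of 1 "x * t x"] t[OF that] nd1 cong_sym by blast
    also have "\<dots> = (1 + K (t x)) mod 3" using mult[OF nd(1) tnd[OF that]] nd(2) by simp
    finally have "(1 + K (t x)) mod 3 = 0" using K1 by simp
    then show ?thesis using less[OF tnd[OF that]] by presburger
  qed
  define h where "h x = (if K (x + 1) = 0 then x else t x)" for x
  define \<phi> where "\<phi> x = (- (h x + 1)) mod int p" for x
  have props: "\<phi> x \<in> F 0 \<and> [\<phi> x + 1 = - h x] (mod int p) \<and> \<not> int p dvd h x \<and>
      K (h x) = (if K (x + 1) = 0 then 1 else 2)" if x: "x \<in> F 1" for x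
  proof -
    have nd: "\<not> int p dvd x" "K x = 1" using x by (auto simp: F_def)
    have nd': "\<not> int p dvd x + 1"
    proof
      assume "int p dvd x + 1"
      then have "[x = - 1] (mod int p)" by (simp add: cong_iff_dvd_diff)
      then have "K x = K (- 1)" using cong nd(1) by blast
      then show False using nd(2) Km1 by simp
    qed
    have "K (x + 1) \<noteq> 2" using no nd nd' by blast
    then have cases: "K (x + 1) = 0 \<or> K (x + 1) = 1" using less[OF nd'] by linarith
    have hK: "\<not> int p dvd h x \<and> K (h x) = (if K (x + 1) = 0 then 1 else 2)"
      using nd tnd[OF x] Kt[OF x] by (simp add: h_def)
    have "\<not> int p dvd h x + 1 \<and> K (h x + 1) = 0"
    proof (cases "K (x + 1) = 0")
      case True then show ?thesis using nd' by (simp add: h_def)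
    next
      case False
      then have K1': "K (x + 1) = 1" using cases by simp
      have "[(x + 1) * t x = t x + 1] (mod int p)"
        using t[OF x] by (simp add: cong_iff_dvd_diff algebra_simps)
      moreover have "\<not> int p dvd (x + 1) * t x"
        using nd' tnd[OF x] P(1) by (simp add: prime_dvd_mult_iff)
      ultimately have "K ((x + 1) * t x) = K (t x + 1)" "\<not> int p dvd t x + 1"
        using cong cong_dvd_iff by blast+
      then show ?thesis using mult[OF nd' tnd[OF x]] K1' Kt[OF x] False by (simp add: h_def)
    qed
    then have h1: "\<not> int p dvd - (h x + 1)" "K (- (h x + 1)) = 0"
      using Kneg[of "h x + 1"] by (auto simp only: dvd_minus_iff)
    have pc: "[\<phi> x = - (h x + 1)] (mod int p)" by (simp add: \<phi>_def)
    have "\<not> int p dvd \<phi> x" using pc h1(1) cong_dvd_iff by blast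
    moreover from this have "K (\<phi> x) = 0" using cong[OF pc] h1(2) by simp
    moreover have "\<phi> x \<in> {0..<int p ^ 1}" using P(2) by (simp add: \<phi>_def)
    ultimately have "\<phi> x \<in> F 0" by (simp add: F_def)
    moreover have "[\<phi> x + 1 = - (h x + 1) + 1] (mod int p)" by (intro cong_add pc cong_refl)
    ultimately show ?thesis using hK by simp
  qed
  have "inj_on \<phi> (F 1)"
  proof (rule inj_onI)
    fix x y assume x: "x \<in> F 1" and y: "y \<in> F 1" and eq: "\<phi> x = \<phi> y"
    have "[- h x = - h y] (mod int p)"
      using props[OF x] props[OF y] eq by (metis cong_sym cong_trans)
    then have hh: "[h x = h y] (mod int p)" by (simp add: cong_minus_minus_iff)
    \<comment> \<open>The class of \<open>h x\<close> is 1 or 2 according to the branch of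
      \<open>h\<close>, so equal values come from the same branch.\<close>
    have "K (h x) = K (h y)" using cong hh props[OF x] by blast
    moreover have "K (h x) = (if K (x + 1) = 0 then 1 else 2)" using props[OF x] by blast
    moreover have "K (h y) = (if K (y + 1) = 0 then 1 else 2)" using props[OF y] by blast
    ultimately have same: "K (x + 1) = 0 \<longleftrightarrow> K (y + 1) = 0"
      by (metis numeral_eq_one_iff semiring_norm(85))
    have "[x = y] (mod int p)"
    proof (cases "K (x + 1) = 0")
      case True then show ?thesis using hh same by (simp add: h_def)
    next
      case False
      then have "[t x = t y] (mod int p)" using hh same by (simp add: h_def)
      then have "[x * y * t x = x * y * t y] (mod int p)" by (rule cong_scalar_left)
      moreover have "[x * y * t x = y * 1] (mod int p)"
        using cong_scalar_left[OF t[OF x], of y] by (simp add: algebra_simps)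
      moreover have "[x * y * t y = x * 1] (mod int p)"
        using cong_scalar_left[OF t[OF y], of x] by (simp add: algebra_simps)
      ultimately show ?thesis by (metis cong_sym cong_trans mult.right_neutral)
    qed
    then show "x = y" using x y by (simp add: F_def cong_def)
  qed
  moreover have "\<phi> ` F 1 \<subseteq> F 0 - {int p - 1}"
  proof safe
    fix x assume x: "x \<in> F 1"
    show "\<phi> x \<in> F 0" using props[OF x] by blast
    assume "\<phi> x = int p - 1"
    then have "int p dvd \<phi> x + 1" by simp
    then have "int p dvd - h x" using props[OF x] cong_dvd_iff by blast
    then show False using props[OF x] by simp
  qed
  ultimately have "card (F 1) \<le> card (F 0 - {int p - 1})"
    using fin by (intro card_inj_on_le) auto
  moreover have "int p - 1 \<in> F 0"
  proof -
    have c: "[int p - 1 = - 1] (mod int p)" by (simp add: cong_iff_dvd_diff)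
    have "\<not> int p dvd int p - 1" using nd1 c by (simp add: cong_dvd_iff)
    moreover from this have "K (int p - 1) = 0" using cong[OF c] Km1 by simp
    ultimately show ?thesis using P(2) by (simp add: F_def)
  qed
  ultimately show False using FF fin by (metis card_Diff1_less not_le)
qed

definition index_count :: "nat \<Rightarrow> (nat \<Rightarrow> nat) \<Rightarrow> nat \<Rightarrow> nat" where
  "index_count n v r = card {i. i \<le> n \<and> v i mod 3 = r}"

context cube_classes
begin

text \<open>Any representative \<open>t j\<close> of the class of \<open>L j\<close> will do: the
  two differ by a cube modulo \<open>p ^ (e + 1)\<close>, and the variable absorbs it.\<close>

lemma reduced_zeroI_classes:
  assumes J: "J \<subseteq> {..n}" "i \<in> J"
    and s: "\<And>j. j \<in> J \<Longrightarrow> s j mod 3 = v j mod 3" "\<And>j. j \<in> J \<Longrightarrow> s i \<le> s j"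
    and L: "\<And>j. j \<in> J \<Longrightarrow> \<not> int p dvd L j"
    and t: "\<And>j. j \<in> J \<Longrightarrow> \<not> int p dvd t j" "\<And>j. j \<in> J \<Longrightarrow> K (t j) = K (L j)"
    and d: "int p ^ (e + 1) dvd (\<Sum>j\<in>J. int p ^ (s j - s i) * t j)"
  shows "reduced_zero (int p) e n v L"
proof -
  have "\<forall>j\<in>J. \<exists>y. [t j = L j * y ^ 3] (mod int p ^ (e + 1))"
    using K_eq_iff t L by blast
  then obtain y where y: "\<And>j. j \<in> J \<Longrightarrow> [t j = L j * y j ^ 3] (mod int p ^ (e + 1))" by metis
  have unit: "\<not> int p dvd y j" if j: "j \<in> J" for j
  proof
    assume "int p dvd y j"
    then have "int p dvd L j * y j ^ 3" by (simp add: power3_eq_cube)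
    moreover have "[t j = L j * y j ^ 3] (mod int p)"
      using y[OF j] by (rule cong_dvd_modulus) simp
    ultimately show False using t(1)[OF j] by (simp add: cong_dvd_iff)
  qed
  have "[(\<Sum>j\<in>J. int p ^ (s j - s i) * t j) = (\<Sum>j\<in>J. int p ^ (s j - s i) * (L j * y j ^ 3))] (mod int p ^ (e + 1))"
    by (intro cong_sum cong_mult cong_refl y)
  then have "int p ^ (e + 1) dvd (\<Sum>j\<in>J. int p ^ (s j - s i) * (L j * y j ^ 3))"
    using d cong_dvd_iff by blast
  then have "int p ^ (e + 1) dvd (\<Sum>j\<in>J. int p ^ (s j - s i) * L j * y j ^ 3)"
    by (simp only: mult.assoc)
  moreover have "\<forall>j\<in>J. s j mod 3 = v j mod 3 \<and> s i \<le> s j \<and> \<not> int p dvd y j"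
    using s unit by blast
  ultimately show ?thesis
    unfolding reduced_zero_def using J
    by (intro exI[of _ J] exI[of _ i] exI[of _ s] exI[of _ y] conjI)
qed

lemma inj_on_K_level:
  assumes "inj_on (\<lambda>i. (v i mod 3, K (L i))) {..n}"
    and "J \<subseteq> {..n}" "\<And>j. j \<in> J \<Longrightarrow> v j mod 3 = r"
  shows "inj_on (\<lambda>j. K (L j)) J"
  using assms by (auto simp: inj_on_def subset_iff)

end

section \<open>Primes congruent to 2 modulo 3\<close>

lemma cube_classes_2_mod_3:
  assumes p: "prime p" "p mod 3 = 2"
  shows "cube_classes p 0 1 3 (\<lambda>_. 0)"
proof
  show "prime p" by fact
  show "(3::int) = 3 * int p ^ 0" by simp
  show "\<not> int p dvd 3"
  proof
    assume "int p dvd 3"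
    then have "int p dvd int 3" by simp
    then have "p dvd 3" by (simp only: int_dvd_int_iff)
    moreover have "prime (3::nat)" by simp
    ultimately have "p = 3" using p(1) primes_dvd_imp_eq by blast
    then show False using p(2) by simp
  qed
  obtain g l where g: "\<not> int p dvd g" "\<And>u. \<not> int p dvd u \<Longrightarrow> [u = g ^ l u] (mod int p)"
    "\<And>i j. [g ^ i = g ^ j] (mod int p) \<longleftrightarrow> [i = j] (mod (p - 1))"
    by (rule discrete_log_exists[OF p(1)]) (rule that)
  fix u w :: int assume u: "\<not> int p dvd u" and w: "\<not> int p dvd w"
  define m where "m = p div 3"
  \<comment> \<open>With \<open>p = 3 * m + 2\<close>, the number \<open>2 * m + 1\<close> inverts
    \<open>3\<close> modulo \<open>p - 1 = 3 * m + 1\<close>, and \<open>p - 2\<close> acts as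
    \<open>-1\<close> there. So \<open>3 * k\<close> is \<open>l u - l w\<close> modulo
    \<open>p - 1\<close>, and all units lie in one class.\<close>
  define k where "k = (2 * m + 1) * (l u + (p - 2) * l w)"
  have pm: "p = 3 * m + 2" using p(2) unfolding m_def by presburger
  have "l w + 3 * k = l u + (p - 1) * (l w + 2 * (l u + (p - 2) * l w))"
    unfolding k_def pm by (simp add: algebra_simps)
  then have "[l w + 3 * k = l u] (mod (p - 1))" by (simp add: cong_def)
  then have "[g ^ (l w + 3 * k) = g ^ l u] (mod int p)" using g(3) by blast
  then have "[g ^ l u = g ^ l w * (g ^ k) ^ 3] (mod int p)"
    by (simp add: power_add power_mult[symmetric] mult.commute cong_sym)
  moreover have "[g ^ l w * (g ^ k) ^ 3 = w * (g ^ k) ^ 3] (mod int p)"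
    by (intro cong_mult cong_refl cong_sym[OF g(2)] w)
  ultimately have "[u = w * (g ^ k) ^ 3] (mod int p)" using g(2)[OF u] by (meson cong_trans)
  then show "(0::nat) = 0 \<longleftrightarrow> (\<exists>y. [u = w * y ^ 3] (mod int p ^ (0 + 1)))" by auto
qed (use card_units_mod_square[OF p(1)] in auto)

lemma not_reduced_zero_iff_2_mod_3:
  assumes p: "prime p" "p mod 3 = 2" and L: "\<And>i. i \<le> n \<Longrightarrow> \<not> int p dvd L i"
  shows "\<not> reduced_zero (int p) 0 n v L \<longleftrightarrow> inj_on (\<lambda>i. (v i mod 3, 0 :: nat)) {..n}"
proof -
  interpret cube_classes p 0 1 3 "\<lambda>_. 0" by (rule cube_classes_2_mod_3[OF p])
  have "\<not> reduced_zero (int p) 0 n v L" if inj: "inj_on (\<lambda>i. (v i mod 3, 0 :: nat)) {..n}"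
  proof (rule not_reduced_zero_if_fibres_le_2)
    fix i
    have "card {j. j \<le> n \<and> v j mod 3 = v i mod 3} \<le> card {v i mod 3}"
      using inj by (intro card_inj_on_le[of "\<lambda>j. v j mod 3"]) (auto simp: inj_on_def)
    then show "card {j. j \<le> n \<and> v j mod 3 = v i mod 3} \<le> 2" by simp
  qed (use L inj in auto)
  then show ?thesis using reduced_zero_if_not_inj[of n L v] L by blast
qed

section \<open>Primes congruent to 1 modulo 3\<close>

lemma cube_classes_1_mod_3:
  assumes p: "prime p" "p mod 3 = 1"
  obtains K x where "cube_classes p 0 3 3 K" "\<not> int p dvd x" "\<not> int p dvd x + 1"
    "K 1 = 0" "K x = 1" "K (- (x + 1)) = 2"
proof -
  obtain g l where g: "\<not> int p dvd g" "\<And>u. \<not> int p dvd u \<Longrightarrow> [u = g ^ l u] (mod int p)"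
    "\<And>i j. [g ^ i = g ^ j] (mod int p) \<longleftrightarrow> [i = j] (mod (p - 1))"
    by (rule discrete_log_exists[OF p(1)]) (rule that)
  have P: "prime (int p)" using p(1) by simp
  have p1: "p > 1" using p(1) by (rule prime_gt_1_nat)
  have "3 dvd p - 1" using p(2) p1 by (metis dvd_minus_mod)
  then have g3: "i mod 3 = j mod 3" if "[g ^ i = g ^ j] (mod int p)" for i j
  proof -
    have "[i = j] (mod (p - 1))" using that g(3) by simp
    then have "[i = j] (mod 3)" using \<open>3 dvd p - 1\<close> by (rule cong_dvd_modulus_nat)
    then show ?thesis by (simp add: cong_def)
  qed
  have gpow: "\<not> int p dvd g ^ k" for k using g(1) P prime_dvd_power by blast
  \<comment> \<open>The logarithm is determined modulo \<open>p - 1\<close>, a multiple of 3, so its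
    residue modulo 3 is a homomorphism, with the cubes as kernel.\<close>
  define K where "K u = l u mod 3" for u
  have Kg: "K u = k mod 3" if "[u = g ^ k] (mod int p)" for u k
  proof -
    have "\<not> int p dvd u" using that gpow cong_dvd_iff by blast
    then have "[g ^ l u = g ^ k] (mod int p)" using that g(2) cong_sym cong_trans by blast
    then show ?thesis unfolding K_def by (rule g3)
  qed
  have cong: "K u = K w" if "[u = w] (mod int p)" "\<not> int p dvd u" for u w
  proof -
    have "\<not> int p dvd w" using that cong_dvd_iff by blast
    then have "[u = g ^ l w] (mod int p)" using that(1) g(2) cong_trans by blast
    then show ?thesis using Kg by (simp add: K_def)
  qed
  have mult: "K (u * w) = (K u + K w) mod 3" if "\<not> int p dvd u" "\<not> int p dvd w" for u w
  proof -
    have "[u * w = g ^ l u * g ^ l w] (mod int p)" by (intro cong_mult g(2) that)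
    then have "K (u * w) = (l u + l w) mod 3" using Kg by (simp add: power_add[symmetric])
    then show ?thesis by (simp add: K_def mod_add_eq)
  qed
  have less: "K u < 3" for u by (simp add: K_def)
  have Kgg: "K g = 1" using Kg[of g 1] by simp
  have K1: "K 1 = 0" using Kg[of 1 0] by simp
  have cc: "cube_classes p 0 3 3 K"
  proof
    show "prime p" by fact
    show "(3::int) = 3 * int p ^ 0" by simp
    show "\<not> int p dvd 3"
    proof
      assume "int p dvd 3"
      then have "int p dvd int 3" by simp
      then have "p dvd 3" by (simp only: int_dvd_int_iff)
      moreover have "prime (3::nat)" by simp
      ultimately have "p = 3" using p(1) primes_dvd_imp_eq by blast
      then show False using p(2) by simp
    qed
    show "K u = K w \<longleftrightarrow> (\<exists>y. [u = w * y ^ 3] (mod int p ^ (0 + 1)))"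
      if u: "\<not> int p dvd u" and w: "\<not> int p dvd w" for u w
    proof
      assume "K u = K w"
      \<comment> \<open>Adding \<open>(p - 1) * l w\<close> changes neither the power of
        \<open>g\<close> nor the residue modulo 3, and makes the exponent exceed \<open>l w\<close>
        by a natural multiple of 3.\<close>
      have "l w \<le> l u + (p - 1) * l w" using p1 by (cases "p - 1") auto
      moreover have "(l u + (p - 1) * l w) mod 3 = l w mod 3"
      proof -
        have "3 dvd (p - 1) * l w" using \<open>3 dvd p - 1\<close> by simp
        then obtain t where "(p - 1) * l w = 3 * t" by blast
        then show ?thesis using \<open>K u = K w\<close> by (simp add: K_def)
      qed
      ultimately obtain q where q: "l u + (p - 1) * l w = l w + 3 * q" using mod3_eq_imp_offset by blast
      have "[l u = l u + (p - 1) * l w] (mod (p - 1))" by (simp add: cong_def)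
      then have "[g ^ l u = g ^ (l w + 3 * q)] (mod int p)" unfolding q[symmetric] using g(3) by blast
      then have "[g ^ l u = g ^ l w * (g ^ q) ^ 3] (mod int p)"
        by (simp add: power_add power_mult[symmetric] mult.commute)
      moreover have "[g ^ l w * (g ^ q) ^ 3 = w * (g ^ q) ^ 3] (mod int p)"
        by (intro cong_mult cong_refl cong_sym[OF g(2)] w)
      ultimately have "[u = w * (g ^ q) ^ 3] (mod int p)" using g(2)[OF u] by (meson cong_trans)
      then show "\<exists>y. [u = w * y ^ 3] (mod int p ^ (0 + 1))" by auto
    next
      assume "\<exists>y. [u = w * y ^ 3] (mod int p ^ (0 + 1))"
      then obtain y where y: "[u = w * y ^ 3] (mod int p)" by auto
      then have "\<not> int p dvd w * y ^ 3" using u cong_dvd_iff by blast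
      then have "\<not> int p dvd y" by (auto simp: power3_eq_cube)
      then have "[w * y ^ 3 = g ^ l w * (g ^ l y) ^ 3] (mod int p)"
        by (intro cong_mult cong_pow g(2) w)
      with y have "[u = g ^ l w * (g ^ l y) ^ 3] (mod int p)" by (rule cong_trans)
      then have "[u = g ^ (l w + 3 * l y)] (mod int p)"
        by (simp add: power_add power_mult[symmetric] mult.commute)
      then show "K u = K w" using Kg by (simp add: K_def)
    qed
    show "3 * card {L \<in> {0..<int p ^ 2}. \<not> int p dvd L \<and> K L = r} = p * (p - 1)" if "r < 3" for r
    proof (rule card_fibres_mod_square[OF p(1) _ less that])
      fix r :: nat assume r: "r < 3"
      show "card {L \<in> {0..<int p ^ 2}. \<not> int p dvd L \<and> K L = r} = card {L \<in> {0..<int p ^ 2}. \<not> int p dvd L \<and> K L = 0}"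
      proof (rule card_fibres_equal[OF p(1) _ g(1) _ _ r])
        show "K (g * u) = Suc (K u) mod 3" if "\<not> int p dvd u" for u
          using mult[OF g(1) that] Kgg by simp
      qed (use cong in auto)
    qed
  qed (use less in auto)
  interpret cube_classes p 0 3 3 K by (rule cc)
  obtain x where x: "\<not> int p dvd x" "K x = 1" "\<not> int p dvd x + 1" "K (x + 1) = 2"
    using consecutive_cube_classes[OF p(1) cong mult less g(1) Kgg] by blast
  have "K (- (x + 1)) = K (x + 1)"
    using x(3) by (intro cube_sum_imp_K_eq[of _ _ 1 1]) (use p1 in \<open>auto simp only: dvd_minus_iff power_one mult_1_right, auto\<close>)
  then show thesis using that[OF cc x(1,3) K1 x(2)] x(4) by simp
qed

text \<open>The units \<open>1\<close>, \<open>x\<close> and \<open>-(x + 1)\<close> represent the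
  three classes and sum to zero. A level with three indices of distinct types contains each class
  once, so it carries this zero by itself.\<close>

lemma not_reduced_zero_iff_1_mod_3:
  assumes p: "prime p" "p mod 3 = 1"
  obtains K where "cube_classes p 0 3 3 K"
    "\<And>n v L. (\<And>i. i \<le> n \<Longrightarrow> \<not> int p dvd L i) \<Longrightarrow>
      \<not> reduced_zero (int p) 0 n v L \<longleftrightarrow>
        inj_on (\<lambda>i. (v i mod 3, K (L i))) {..n} \<and> (\<forall>r<3. index_count n v r \<le> 2)"
proof -
  obtain K x where K: "cube_classes p 0 3 3 K" and x: "\<not> int p dvd x" "\<not> int p dvd x + 1"
    "K 1 = 0" "K x = 1" "K (- (x + 1)) = 2"
    by (rule cube_classes_1_mod_3[OF p]) (rule that)
  interpret cube_classes p 0 3 3 K by (rule K)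
  define t where "t k = (if k = 0 then 1 else if k = 1 then x else - (x + 1))" for k :: nat
  have p1: "int p > 1" using prime_gt_1_nat[OF p(1)] by simp
  have t: "\<not> int p dvd t k" for k using x(1,2) p1 by (auto simp only: t_def dvd_minus_iff split: if_splits)
  have Kt: "K (t k) = k" if "k < 3" for k
  proof -
    have "k = 0 \<or> k = 1 \<or> k = 2" using that by linarith
    then show ?thesis using x by (auto simp: t_def)
  qed
  have tsum: "(\<Sum>k<3. t k) = 0" by (simp add: t_def numeral_3_eq_3)
  have iff: "\<not> reduced_zero (int p) 0 n v L \<longleftrightarrow>
        inj_on (\<lambda>i. (v i mod 3, K (L i))) {..n} \<and> (\<forall>r<3. index_count n v r \<le> 2)"
    if L: "\<And>i. i \<le> n \<Longrightarrow> \<not> int p dvd L i" for n v L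
  proof
    assume nrz: "\<not> reduced_zero (int p) 0 n v L"
    then have inj: "inj_on (\<lambda>i. (v i mod 3, K (L i))) {..n}"
      using reduced_zero_if_not_inj[of n L v] L by blast
    have "index_count n v r \<le> 2" for r
    proof (rule ccontr)
      assume "\<not> index_count n v r \<le> 2"
      define J where "J = {i. i \<le> n \<and> v i mod 3 = r}"
      have J: "J \<subseteq> {..n}" by (auto simp: J_def)
      have card: "card J \<ge> 3" using \<open>\<not> index_count n v r \<le> 2\<close> by (simp add: index_count_def J_def)
      have injJ: "inj_on (\<lambda>j. K (L j)) J" by (rule inj_on_K_level[OF inj J, of r]) (simp add: J_def)
      have "(\<lambda>j. K (L j)) ` J \<subseteq> {..<3}" using K_less L J by auto
      then have im: "(\<lambda>j. K (L j)) ` J = {..<3}"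
        using card card_image[OF injJ] by (intro card_seteq) auto
      have "J \<noteq> {}" using card by auto
      then obtain i where i: "i \<in> J" by blast
      have "(\<Sum>j\<in>J. t (K (L j))) = (\<Sum>k<3. t k)"
        using sum.reindex[OF injJ, of t] im by simp
      then have "reduced_zero (int p) 0 n v L"
        using J i L t Kt K_less tsum
        by (intro reduced_zeroI_classes[of J n i "\<lambda>_. r mod 3" v L "\<lambda>j. t (K (L j))"])
           (auto simp: J_def)
      then show False using nrz by blast
    qed
    then show "inj_on (\<lambda>i. (v i mod 3, K (L i))) {..n} \<and> (\<forall>r<3. index_count n v r \<le> 2)"
      using inj by blast
  next
    assume *: "inj_on (\<lambda>i. (v i mod 3, K (L i))) {..n} \<and> (\<forall>r<3. index_count n v r \<le> 2)"
    show "\<not> reduced_zero (int p) 0 n v L"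
    proof (rule not_reduced_zero_if_fibres_le_2)
      show "card {j. j \<le> n \<and> v j mod 3 = v i mod 3} \<le> 2" for i
        using * unfolding index_count_def by simp
    qed (use L * in auto)
  qed
  show thesis by (rule that[OF K iff])
qed

section \<open>The prime 3: units and cubes modulo 9\<close>

definition K9 :: "int \<Rightarrow> nat" where
  "K9 u = (if u mod 9 = 1 \<or> u mod 9 = 8 then 0 else if u mod 9 = 2 \<or> u mod 9 = 7 then 1 else 2)"

text \<open>Up to sign the units modulo 9 are \<open>1\<close>, \<open>2\<close> and
  \<open>4\<close>, while the cubes of units are just \<open>1\<close> and \<open>-1\<close>; the
  exponent of \<open>2\<close> therefore names the class.\<close>

lemma unit_mod_9_cases:
  assumes "\<not> (3::int) dvd u"
  obtains s :: int where "s = 1 \<or> s = - 1" "[u = s * 2 ^ K9 u] (mod 9)"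
proof -
  have units: "m = 1 \<or> m = 2 \<or> m = 4 \<or> m = 5 \<or> m = 7 \<or> m = 8"
    if "0 \<le> m" "m < 9" "m mod 3 \<noteq> 0" for m :: int
    using that by presburger
  have "u mod 9 mod 3 = u mod 3" by (simp add: mod_mod_cancel)
  then have "u mod 9 mod 3 \<noteq> 0" using assms by (simp only: mod_eq_0_iff_dvd not_False_eq_True)
  then consider "u mod 9 = 1" | "u mod 9 = 2" | "u mod 9 = 4" | "u mod 9 = 5" | "u mod 9 = 7" | "u mod 9 = 8"
    using units[of "u mod 9"] by auto
  then have "[u = 1 * 2 ^ K9 u] (mod 9) \<or> [u = (- 1) * 2 ^ K9 u] (mod 9)"
    by cases (simp_all add: K9_def cong_def)
  then show thesis using that by blast
qed

lemma cube_mod_9: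
  assumes "\<not> (3::int) dvd y"
  shows "[y ^ 3 = 1] (mod 9) \<or> [y ^ 3 = - 1] (mod 9)"
proof -
  obtain s :: int where s: "s = 1 \<or> s = - 1" "[y = s * 2 ^ K9 y] (mod 9)"
    using unit_mod_9_cases[OF assms] by blast
  have "[y ^ 3 = (s * 2 ^ K9 y) ^ 3] (mod 9)" by (rule cong_pow[OF s(2)])
  moreover have "K9 y = 0 \<or> K9 y = 1 \<or> K9 y = 2" by (simp add: K9_def)
  then have "[(s * 2 ^ K9 y) ^ 3 = 1] (mod 9) \<or> [(s * 2 ^ K9 y) ^ 3 = - 1] (mod 9)"
    using s(1) by (auto simp: cong_def)
  ultimately show ?thesis using cong_trans by blast
qed

lemma K9_cong: "[u = w] (mod 9) \<Longrightarrow> K9 u = K9 w"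
  by (simp add: K9_def cong_def)

lemma K9_minus: "K9 (- u) = K9 u"
  unfolding K9_def by (auto simp: zmod_zminus1_eq_if)

lemma cube_classes_3: "cube_classes 3 1 3 1 K9"
proof
  show "K9 u = K9 w \<longleftrightarrow> (\<exists>y. [u = w * y ^ 3] (mod int 3 ^ (1 + 1)))"
    if u: "\<not> int 3 dvd u" and w: "\<not> int 3 dvd w" for u w
  proof
    assume eq: "K9 u = K9 w"
    obtain s :: int where s: "s = 1 \<or> s = - 1" "[u = s * 2 ^ K9 u] (mod 9)"
      using unit_mod_9_cases[of u] u by auto
    obtain r :: int where r: "r = 1 \<or> r = - 1" "[w = r * 2 ^ K9 w] (mod 9)"
      using unit_mod_9_cases[of w] w by auto
    have "[w * (s * r) ^ 3 = r * 2 ^ K9 w * (s * r) ^ 3] (mod 9)"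
      by (rule cong_scalar_right[OF r(2)])
    also have "r * 2 ^ K9 w * (s * r) ^ 3 = s * 2 ^ K9 u" using s(1) r(1) eq by auto
    finally have "[u = w * (s * r) ^ 3] (mod 9)" using s(2) by (meson cong_sym cong_trans)
    then show "\<exists>y. [u = w * y ^ 3] (mod int 3 ^ (1 + 1))" by auto
  next
    assume "\<exists>y. [u = w * y ^ 3] (mod int 3 ^ (1 + 1))"
    then obtain y where y: "[u = w * y ^ 3] (mod 9)" by auto
    then have "[u = w * y ^ 3] (mod 3)" by (rule cong_dvd_modulus) simp
    then have "\<not> 3 dvd w * y ^ 3" using u cong_dvd_iff by auto
    then have "\<not> 3 dvd y" by (auto simp: power3_eq_cube)
    then have "[w * y ^ 3 = w * 1] (mod 9) \<or> [w * y ^ 3 = w * (- 1)] (mod 9)"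
      using cube_mod_9 cong_scalar_left by blast
    then have "[u = w * 1] (mod 9) \<or> [u = w * (- 1)] (mod 9)" using y cong_trans by blast
    then have "[u = w] (mod 9) \<or> [u = - w] (mod 9)" by simp
    then show "K9 u = K9 w" using K9_cong K9_minus by metis
  qed
  show "3 * card {L \<in> {0..<int 3 ^ 2}. \<not> int 3 dvd L \<and> K9 L = r} = 3 * (3 - 1)" if "r < 3" for r
  proof -
    have "{0..<int 3 ^ 2} = {0..8}" by auto
    also have "\<dots> = set [0..8]" by (simp only: set_upto)
    also have "\<dots> = {0,1,2,3,4,5,6,7,8}" by (simp add: upto.simps del: set_upto)
    finally have all: "{0..<int 3 ^ 2} = {0,1,2,3,4,5,6,7,8}" .
    have "r = 0 \<or> r = 1 \<or> r = 2" using that by linarith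
    moreover have "{L \<in> {0..<int 3 ^ 2}. \<not> int 3 dvd L \<and> K9 L = 0} = {1, 8}"
      unfolding all by (auto simp: K9_def)
    moreover have "{L \<in> {0..<int 3 ^ 2}. \<not> int 3 dvd L \<and> K9 L = 1} = {2, 7}"
      unfolding all by (auto simp: K9_def)
    moreover have "{L \<in> {0..<int 3 ^ 2}. \<not> int 3 dvd L \<and> K9 L = 2} = {4, 5}"
      unfolding all by (auto simp: K9_def)
    ultimately show ?thesis by (elim disjE) simp_all
  qed
qed (auto simp: K9_def)

text \<open>The sum is at most \<open>1 + 2 + 4 = 7\<close> in absolute value, so divisibility by 9
  makes it zero; parity then rules out nonzero digits from the lowest upwards.\<close>

lemma signed_binary_mod_9:
  fixes d :: "nat \<Rightarrow> int"
  assumes d: "\<And>k. d k \<in> {- 1, 0, 1}" and dvd: "9 dvd (\<Sum>k<3. d k * 2 ^ k)" and k: "k < 3"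
  shows "d k = 0"
proof -
  have "(\<Sum>k<3. d k * 2 ^ k) = d 0 + 2 * d 1 + 4 * d 2" by (simp add: numeral_3_eq_3 numeral_2_eq_2)
  with dvd obtain q where q: "d 0 + 2 * d 1 + 4 * d 2 = 9 * q" by (auto elim: dvdE)
  have b: "- 1 \<le> d k \<and> d k \<le> 1" for k using d[of k] by auto
  have "q = 0" using q b[of 0] b[of 1] b[of 2] by linarith
  then have "d 0 = 0 \<and> d 1 = 0 \<and> d 2 = 0" using q d[of 0] d[of 1] d[of 2] by auto
  moreover have "k = 0 \<or> k = 1 \<or> k = 2" using k by linarith
  ultimately show ?thesis by auto
qed

text \<open>Up to order the witnesses are \<open>1 + 2\<close>, \<open>-1 + 4\<close> and
  \<open>-2 - 4\<close>. Different classes cannot cancel modulo 9, but they can reach 3, which a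
  term of the next higher valuation can remove.\<close>

lemma K9_pair_sum_3:
  assumes "a < 3" "b < 3" "a \<noteq> b"
  shows "\<exists>x y. \<not> 3 dvd x \<and> \<not> 3 dvd y \<and> K9 x = a \<and> K9 y = b \<and> 9 dvd x + y - 3"
proof -
  consider "a = 0" "b = 1" | "a = 0" "b = 2" | "a = 1" "b = 0" | "a = 1" "b = 2" | "a = 2" "b = 0" | "a = 2" "b = 1"
  proof -
    have "a = 0 \<or> a = 1 \<or> a = 2" "b = 0 \<or> b = 1 \<or> b = 2" using assms by linarith+
    then show thesis using that assms(3) by blast
  qed
  then show ?thesis
  proof cases
    case 1 then show ?thesis by (intro exI[of _ 1] exI[of _ 2]) (simp add: K9_def)
  next
    case 2 then show ?thesis by (intro exI[of _ "-1"] exI[of _ 4]) (simp add: K9_def)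
  next
    case 3 then show ?thesis by (intro exI[of _ 2] exI[of _ 1]) (simp add: K9_def)
  next
    case 4 then show ?thesis by (intro exI[of _ "-2"] exI[of _ "-4"]) (simp add: K9_def)
  next
    case 5 then show ?thesis by (intro exI[of _ 4] exI[of _ "-1"]) (simp add: K9_def)
  next
    case 6 then show ?thesis by (intro exI[of _ "-4"] exI[of _ "-2"]) (simp add: K9_def)
  qed
qed

text \<open>Classes are closed under sign, so each contains a unit congruent to \<open>-1\<close>
  modulo 3. Three times it is \<open>-3\<close> modulo 9, which cancels the sum of a pair from one
  level below.\<close>

lemma K9_minus_1_mod_3:
  assumes "a < 3"
  shows "\<exists>z. \<not> 3 dvd z \<and> K9 z = a \<and> 3 dvd z + 1"
proof -
  consider "a = 0" | "a = 1" | "a = 2" using assms by linarith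
  then show ?thesis
  proof cases
    case 1 then show ?thesis by (intro exI[of _ "-1"]) (simp add: K9_def)
  next
    case 2 then show ?thesis by (intro exI[of _ 2]) (simp add: K9_def)
  next
    case 3 then show ?thesis by (intro exI[of _ "-4"]) (simp add: K9_def)
  qed
qed

lemma not_reduced_zero_iff_3:
  assumes L: "\<And>i. i \<le> n \<Longrightarrow> \<not> (3::int) dvd L i"
  shows "\<not> reduced_zero 3 1 n v L \<longleftrightarrow>
        inj_on (\<lambda>i. (v i mod 3, K9 (L i))) {..n} \<and>
        (\<forall>r<3. 2 \<le> index_count n v r \<longrightarrow> index_count n v (Suc r mod 3) = 0)"
proof -
  interpret cube_classes 3 1 3 1 K9 by (rule cube_classes_3)
  have L': "\<And>i. i \<le> n \<Longrightarrow> \<not> int 3 dvd L i" using L by simp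
  show ?thesis
  proof
    assume nrz: "\<not> reduced_zero 3 1 n v L"
    then have inj: "inj_on (\<lambda>i. (v i mod 3, K9 (L i))) {..n}"
      using reduced_zero_if_not_inj[of n L v] L' by auto
    have "index_count n v (Suc r mod 3) = 0" if r: "r < 3" "2 \<le> index_count n v r" for r
    proof (rule ccontr)
      assume "index_count n v (Suc r mod 3) \<noteq> 0"
      then have "{i. i \<le> n \<and> v i mod 3 = Suc r mod 3} \<noteq> {}" unfolding index_count_def by (metis card.empty)
      then obtain l where l: "l \<le> n" "v l mod 3 = Suc r mod 3" by blast
      obtain i j where ij: "i \<le> n" "v i mod 3 = r" "j \<le> n" "v j mod 3 = r" "i \<noteq> j"
      proof -
        have "\<not> card {i. i \<le> n \<and> v i mod 3 = r} \<le> Suc 0"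
          using r(2) unfolding index_count_def by linarith
        then show thesis using that by (subst (asm) card_le_Suc0_iff_eq) auto
      qed
      have K: "K9 (L i) \<noteq> K9 (L j)" using inj ij by (auto simp: inj_on_def)
      have lt: "K9 u < 3" for u by (simp add: K9_def)
      obtain a b where ab: "\<not> 3 dvd a" "\<not> 3 dvd b" "K9 a = K9 (L i)" "K9 b = K9 (L j)" "9 dvd a + b - 3"
        using K9_pair_sum_3[OF lt lt K] by blast
      obtain c where c: "\<not> 3 dvd c" "K9 c = K9 (L l)" "3 dvd c + 1"
        using K9_minus_1_mod_3[OF lt] by blast
      have "9 dvd 3 * (c + 1)" using mult_dvd_mono[OF dvd_refl[of 3] c(3)] by simp
      then have "9 dvd (a + b - 3) + 3 * (c + 1)" by (rule dvd_add[OF ab(5)])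
      then have d: "9 dvd a + b + 3 * c" by (simp add: algebra_simps)
      have "l \<noteq> i" "l \<noteq> j" using l ij r(1) by (auto simp: mod_Suc split: if_splits)
      \<comment> \<open>The exponent of \<open>l\<close> is \<open>r + 1\<close> and not
        \<open>Suc r mod 3\<close>: for \<open>r = 2\<close> the level of \<open>l\<close> is 0, but
        its term must lie just above the pair.\<close>
      define s where "s x = (if x = l then r + 1 else r)" for x
      define t where "t x = (if x = l then c else if x = i then a else b)" for x
      have "reduced_zero (int 3) 1 n v L"
      proof (rule reduced_zeroI_classes[of "{i, j, l}" n i s v L t])
        show "int 3 ^ (1 + 1) dvd (\<Sum>x\<in>{i, j, l}. int 3 ^ (s x - s i) * t x)"
          using \<open>l \<noteq> i\<close> \<open>l \<noteq> j\<close> ij(5) d by (simp add: s_def t_def algebra_simps)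
        show "s x mod 3 = v x mod 3" if "x \<in> {i, j, l}" for x
          using that ij l r(1) by (auto simp: s_def)
      qed (use \<open>l \<noteq> i\<close> \<open>l \<noteq> j\<close> ij l L' ab c in \<open>auto simp: s_def t_def\<close>)
      then show False using nrz by simp
    qed
    then show "inj_on (\<lambda>i. (v i mod 3, K9 (L i))) {..n} \<and>
        (\<forall>r<3. 2 \<le> index_count n v r \<longrightarrow> index_count n v (Suc r mod 3) = 0)" using inj by blast
  next
    assume *: "inj_on (\<lambda>i. (v i mod 3, K9 (L i))) {..n} \<and>
        (\<forall>r<3. 2 \<le> index_count n v r \<longrightarrow> index_count n v (Suc r mod 3) = 0)"
    show "\<not> reduced_zero 3 1 n v L"
    proof
      assume "reduced_zero 3 1 n v L"
      then have rz: "reduced_zero (int 3) 1 n v L" by simp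
      obtain J i y where J: "J \<subseteq> {..n}" "i \<in> J" "\<And>j. j \<in> J \<Longrightarrow> v j mod 3 = v i mod 3"
        "\<And>j. j \<in> J \<Longrightarrow> \<not> int 3 dvd y j" "J \<noteq> {i}"
        "int 3 dvd (\<Sum>j\<in>J. L j * y j ^ 3)"
        "(\<And>l. l \<le> n \<Longrightarrow> v l mod 3 \<noteq> (v i + 1) mod 3) \<Longrightarrow> int 3 ^ (1 + 1) dvd (\<Sum>j\<in>J. L j * y j ^ 3)"
      proof (rule reduced_zero_leading_part[OF _ rz])
        show "\<not> int 3 dvd L i" if "i \<le> n" for i using that by (rule L')
        fix J i y assume "J \<subseteq> {..n}" "i \<in> J" "\<And>j. j \<in> J \<Longrightarrow> v j mod 3 = v i mod 3"
          "\<And>j. j \<in> J \<Longrightarrow> \<not> int 3 dvd y j" "J \<noteq> {i}" "int 3 dvd (\<Sum>j\<in>J. L j * y j ^ 3)"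
          "(\<And>l. l \<le> n \<Longrightarrow> v l mod 3 \<noteq> (v i + 1) mod 3) \<Longrightarrow> int 3 ^ (1 + 1) dvd (\<Sum>j\<in>J. L j * y j ^ 3)"
        then show thesis by (rule that)
      qed
      have fin: "finite J" using J(1) finite_subset by blast
      obtain j where j: "j \<in> J" "j \<noteq> i" using J(2,5) by blast
      define r where "r = v i mod 3"
      \<comment> \<open>Two leading terms share the level, so the next level is empty, and the
        leading part vanishes modulo 9 rather than only modulo 3.\<close>
      have "card {i, j} \<le> index_count n v r" unfolding index_count_def
        using J(1,2) J(3)[OF j(1)] j(1) by (intro card_mono) (auto simp: r_def)
      then have "index_count n v (Suc r mod 3) = 0" using * j(2) by (simp add: r_def)
      then have "{l. l \<le> n \<and> v l mod 3 = Suc r mod 3} = {}"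
        unfolding index_count_def by (subst (asm) card_0_eq) auto
      then have "v l mod 3 \<noteq> (v i + 1) mod 3" if "l \<le> n" for l
        using that by (auto simp: r_def mod_Suc_eq)
      then have d9: "9 dvd (\<Sum>j\<in>J. L j * y j ^ 3)" using J(7) by auto
      have "\<exists>s::int. (s = 1 \<or> s = - 1) \<and> [L j * y j ^ 3 = s * 2 ^ K9 (L j)] (mod 9)" if j: "j \<in> J" for j
      proof -
        obtain a :: int where a: "a = 1 \<or> a = - 1" "[L j = a * 2 ^ K9 (L j)] (mod 9)"
          using unit_mod_9_cases[of "L j"] L[of j] J(1) j by auto
        obtain b :: int where b: "b = 1 \<or> b = - 1" "[y j ^ 3 = b] (mod 9)"
          using cube_mod_9[of "y j"] J(4)[OF j] by auto
        have "[L j * y j ^ 3 = a * 2 ^ K9 (L j) * b] (mod 9)" by (rule cong_mult[OF a(2) b(2)])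
        then have "[L j * y j ^ 3 = (a * b) * 2 ^ K9 (L j)] (mod 9)" by (simp add: mult_ac)
        moreover have "a * b = 1 \<or> a * b = - 1" using a(1) b(1) by auto
        ultimately show ?thesis by blast
      qed
      then obtain s :: "nat \<Rightarrow> int" where s: "\<And>j. j \<in> J \<Longrightarrow> s j = 1 \<or> s j = - 1"
        "\<And>j. j \<in> J \<Longrightarrow> [L j * y j ^ 3 = s j * 2 ^ K9 (L j)] (mod 9)" by metis
      have inj: "inj_on (\<lambda>j. K9 (L j)) J"
        by (rule inj_on_K_level[OF conjunct1[OF *] J(1) J(3)])
      define f where "f = the_inv_into J (\<lambda>j. K9 (L j))"
      have f: "f (K9 (L j)) = j" if "j \<in> J" for j
        unfolding f_def using the_inv_into_f_f[OF inj that] by simp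
      \<comment> \<open>Distinct classes give distinct powers of \<open>2\<close>, so the signs
        become digits. A class without a leading term gets digit 0, whereas that of
        \<open>L i\<close> has a nonzero one.\<close>
      define d where "d k = (if k \<in> (\<lambda>j. K9 (L j)) ` J then s (f k) else 0)" for k
      have "(\<Sum>k<3. d k * 2 ^ k) = (\<Sum>k\<in>(\<lambda>j. K9 (L j)) ` J. s (f k) * 2 ^ k)"
        by (rule sum.mono_neutral_cong_right) (auto simp: d_def K9_def)
      also have "\<dots> = (\<Sum>j\<in>J. s j * 2 ^ K9 (L j))"
        by (subst sum.reindex[OF inj]) (auto simp: f intro!: sum.cong)
      finally have sum: "(\<Sum>k<3. d k * 2 ^ k) = (\<Sum>j\<in>J. s j * 2 ^ K9 (L j))" .
      have "[(\<Sum>j\<in>J. L j * y j ^ 3) = (\<Sum>j\<in>J. s j * 2 ^ K9 (L j))] (mod 9)"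
        by (intro cong_sum s)
      then have "9 dvd (\<Sum>k<3. d k * 2 ^ k)" unfolding sum using d9 cong_dvd_iff by blast
      moreover have "d k \<in> {- 1, 0, 1}" for k
      proof (cases "k \<in> (\<lambda>j. K9 (L j)) ` J")
        case True
        then obtain j where "j \<in> J" "k = K9 (L j)" by blast
        then show ?thesis using s(1)[of j] f[of j] True by (auto simp: d_def)
      qed (simp add: d_def)
      ultimately have "d (K9 (L i)) = 0" by (intro signed_binary_mod_9) (auto simp: K9_def)
      then show False using J(2) s(1)[OF J(2)] f[OF J(2)] by (auto simp: d_def)
    qed
  qed
qed

section \<open>The distribution of the types\<close>

lemma zp_trunc_digits:
  assumes "p > 0"
  shows "zp_trunc p (\<lambda>j. nat (N div int p ^ j mod int p)) m = N mod int p ^ m"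
proof (induction m)
  case (Suc m)
  have "N mod int p ^ Suc m = int p ^ m * (N div int p ^ m mod int p) + N mod int p ^ m"
    using assms by (simp add: mult.commute[of "int p"] zmod_zmult2_eq)
  then show ?case using Suc assms by (simp add: zp_trunc_def)
qed (simp add: zp_trunc_def)

lemma zp_trunc_bounds:
  assumes "\<And>j. j < m \<Longrightarrow> d j < p"
  shows "0 \<le> zp_trunc p d m \<and> zp_trunc p d m < int p ^ m"
  using assms
proof (induction m)
  case (Suc m)
  then have IH: "0 \<le> zp_trunc p d m" "zp_trunc p d m < int p ^ m" by auto
  have "int (d m) \<le> int p - 1" using Suc.prems[of m] by simp
  then have "int (d m) * int p ^ m \<le> (int p - 1) * int p ^ m" by (intro mult_right_mono) auto
  then have "zp_trunc p d m + int (d m) * int p ^ m < int p ^ Suc m"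
    using IH(2) by (simp add: algebra_simps)
  then show ?case using IH(1) by (simp add: zp_trunc_def)
qed (simp add: zp_trunc_def)

lemma zp_trunc_div_mod:
  assumes "\<And>j. j < m \<Longrightarrow> d j < p" "j < m"
  shows "zp_trunc p d m div int p ^ j mod int p = int (d j)"
proof -
  have p: "p > 0" using assms(1)[OF assms(2)] by simp
  have "[zp_trunc p d m = zp_trunc p d (Suc j)] (mod int p ^ Suc j)"
    using assms(2) by (intro padic_cong padic_zp_trunc) simp
  then obtain k where "zp_trunc p d m = zp_trunc p d (Suc j) + int p ^ Suc j * k"
    by (metis cong_iff_lin cong_sym)
  then have "zp_trunc p d m = zp_trunc p d j + int p ^ j * (int (d j) + int p * k)"
    by (simp add: zp_trunc_def algebra_simps)
  moreover have "zp_trunc p d j div int p ^ j = 0"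
    using zp_trunc_bounds[of j d p] assms by simp
  ultimately have "zp_trunc p d m div int p ^ j = int (d j) + int p * k" using p by simp
  then show ?thesis using assms by simp
qed

text \<open>Fixing a residue modulo \<open>p ^ m\<close> means fixing the first \<open>m\<close>
  digits, which makes it a cylinder event of the product measure.\<close>

lemma zp_trunc_mod_eq_iff:
  assumes "\<And>j. j < m \<Longrightarrow> d j < p" "p > 0" "0 \<le> N" "N < int p ^ m"
  shows "zp_trunc p d m mod int p ^ m = N \<longleftrightarrow> (\<forall>j<m. d j = nat (N div int p ^ j mod int p))"
proof -
  have T: "zp_trunc p d m mod int p ^ m = zp_trunc p d m"
    using zp_trunc_bounds[OF assms(1)] by simp
  show ?thesis
  proof
    assume "zp_trunc p d m mod int p ^ m = N"
    then show "\<forall>j<m. d j = nat (N div int p ^ j mod int p)"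
      using zp_trunc_div_mod[OF assms(1)] T by auto
  next
    assume "\<forall>j<m. d j = nat (N div int p ^ j mod int p)"
    then have "zp_trunc p d m = zp_trunc p (\<lambda>j. nat (N div int p ^ j mod int p)) m"
      unfolding zp_trunc_def by (intro sum.cong) auto
    then show "zp_trunc p d m mod int p ^ m = N"
      using T zp_trunc_digits[OF assms(2), of N m] assms(3,4) by simp
  qed
qed

text \<open>A relation rather than a function: zero has no type, and \<open>L\<close> is determined
  only modulo \<open>p ^ 2\<close>, so uniqueness requires \<open>K\<close> to respect that
  modulus.\<close>

definition has_type :: "nat \<Rightarrow> (int \<Rightarrow> nat) \<Rightarrow> (nat \<Rightarrow> nat) \<Rightarrow> nat \<times> nat \<Rightarrow> bool" where
  "has_type p K d t \<longleftrightarrow> (\<exists>v L. lead (int p) (zp_trunc p d) v L \<and> t = (v mod 3, K L))"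

abbreviation digit_measure :: "nat \<Rightarrow> nat measure" where
  "digit_measure p \<equiv> measure_pmf (pmf_of_set {..<p})"

lemma measurable_count_space_comp2:
  fixes f :: "'a \<Rightarrow> 'b :: countable" and g :: "'a \<Rightarrow> 'c :: countable"
  assumes "f \<in> measurable M (count_space UNIV)" "g \<in> measurable M (count_space UNIV)"
  shows "(\<lambda>x. h (f x) (g x)) \<in> measurable M (count_space UNIV)"
  by (rule measurable_compose_countable[where f = "\<lambda>i x. h i (g x)", OF _ assms(1)])
     (rule measurable_compose[OF assms(2)], simp)

lemma measurable_zp_trunc:
  assumes "\<And>j. (i, j) \<in> J"
  shows "(\<lambda>a. zp_trunc p (\<lambda>j. a (i, j)) m) \<in> measurable (PiM J (\<lambda>_. digit_measure p)) (count_space UNIV)"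
proof (induction m)
  case (Suc m)
  have "(\<lambda>a. a (i, m)) \<in> measurable (PiM J (\<lambda>_. digit_measure p)) (digit_measure p)"
    using assms by (rule measurable_component_singleton)
  then have "(\<lambda>a. a (i, m)) \<in> measurable (PiM J (\<lambda>_. digit_measure p)) (count_space UNIV)"
    by (simp cong: measurable_cong_sets)
  from measurable_count_space_comp2[OF Suc this, of "\<lambda>t k. t + int k * int p ^ m"]
  show ?case by (simp add: zp_trunc_def)
qed (simp add: zp_trunc_def)

lemma sets_Collect_zp_trunc:
  assumes "\<And>j. (i, j) \<in> J"
  shows "{a \<in> space (PiM J (\<lambda>_. digit_measure p)). Q (zp_trunc p (\<lambda>j. a (i, j)) m)}
      \<in> sets (PiM J (\<lambda>_. digit_measure p))"
proof -
  have "(\<lambda>a. zp_trunc p (\<lambda>j. a (i, j)) m) -` {x. Q x} \<inter> space (PiM J (\<lambda>_. digit_measure p))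
      \<in> sets (PiM J (\<lambda>_. digit_measure p))"
    by (rule measurable_sets[OF measurable_zp_trunc[OF assms]]) simp
  then show ?thesis by (simp add: vimage_def Int_def conj_commute)
qed

lemma sets_Collect_has_type:
  assumes "\<And>j. (i, j) \<in> J"
  shows "{a \<in> space (PiM J (\<lambda>_. digit_measure p)). has_type p K (\<lambda>j. a (i, j)) t}
      \<in> sets (PiM J (\<lambda>_. digit_measure p))"
  unfolding has_type_def
  by (intro sets.sets_Collect_countable_Ex sets.sets_Collect_conj sets.sets_Collect_const)
     (unfold lead_def, rule sets_Collect_zp_trunc[OF assms])

lemma has_type_unique:
  assumes "prime p" and K: "\<And>u w. [u = w] (mod int p ^ 2) \<Longrightarrow> \<not> int p dvd u \<Longrightarrow> K u = K w"
    and "has_type p K d t" "has_type p K d s"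
  shows "t = s"
proof -
  obtain v L w M where *: "lead (int p) (zp_trunc p d) v L" "t = (v mod 3, K L)"
    "lead (int p) (zp_trunc p d) w M" "s = (w mod 3, K M)"
    using assms(3,4) unfolding has_type_def by blast
  have "v = w \<and> [L = M] (mod int p ^ 2)"
    using assms(1) * by (intro lead_unique[OF _ padic_zp_trunc]) auto
  then show ?thesis using * K[of L M] by (auto simp: lead_def)
qed

locale haar_digits =
  fixes p n :: nat
  assumes p: "prime p"
begin

sublocale D: product_prob_space "\<lambda>_ :: nat \<times> nat. digit_measure p" "{..n} \<times> UNIV"
  by unfold_locales

abbreviation "H \<equiv> PiM ({..n} \<times> UNIV) (\<lambda>_ :: nat \<times> nat. digit_measure p)"

lemma p_gt_0: "p > 0"
  using p by (rule prime_gt_0_nat)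

lemma pmf_digit: "k < p \<Longrightarrow> measure (digit_measure p) {k} = 1 / p"
  using p_gt_0 by (simp add: measure_pmf_single lessThan_empty_iff)

text \<open>The space of every factor is all of \<open>nat\<close>, so digits are below
  \<open>p\<close> only almost everywhere. Leading terms make sense for all sequences; the bound
  enters when residues are translated into digits.\<close>

lemma AE_digits: "i \<le> n \<Longrightarrow> AE a in H. \<forall>j. a (i, j) < p"
proof -
  assume i: "i \<le> n"
  have "AE x in digit_measure p. x < p"
    using p_gt_0 by (auto simp: AE_measure_pmf_iff lessThan_empty_iff)
  then have "AE a in H. a (i, j) < p" for j
    using i by (intro D.AE_component) auto
  then show ?thesis by (simp add: AE_all_countable)
qed

lemma measure_residue:
  assumes i: "i \<le> n" and N: "0 \<le> N" "N < int p ^ m"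
  shows "measure H {a \<in> space H. zp_trunc p (\<lambda>j. a (i, j)) m mod int p ^ m = N} = 1 / real p ^ m"
proof -
  define X where "X = (\<lambda>(l :: nat, j). {nat (N div int p ^ j mod int p)})"
  have Xs: "{a \<in> space H. \<forall>x\<in>{i} \<times> {..<m}. a x \<in> X x} \<in> sets H"
    using i by (intro sets.sets_Collect_finite_All) (auto intro!: measurable_sets_Collect[OF measurable_component_singleton] sets_Collect_single' )
  have "measure H {a \<in> space H. zp_trunc p (\<lambda>j. a (i, j)) m mod int p ^ m = N}
      = measure H {a \<in> space H. \<forall>x\<in>{i} \<times> {..<m}. a x \<in> X x}"
  proof (rule measure_eq_AE)
    show "AE a in H. (a \<in> {a \<in> space H. zp_trunc p (\<lambda>j. a (i, j)) m mod int p ^ m = N}) =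
       (a \<in> {a \<in> space H. \<forall>x\<in>{i} \<times> {..<m}. a x \<in> X x})"
      using AE_digits[OF i]
    proof (rule AE_mp, intro AE_I2 impI)
      fix a :: "nat \<times> nat \<Rightarrow> nat" assume "\<forall>j. a (i, j) < p"
      then have "zp_trunc p (\<lambda>j. a (i, j)) m mod int p ^ m = N \<longleftrightarrow> (\<forall>j<m. a (i, j) = nat (N div int p ^ j mod int p))"
        using zp_trunc_mod_eq_iff[of m "\<lambda>j. a (i, j)" p N] p_gt_0 N by blast
      then show "(a \<in> {a \<in> space H. zp_trunc p (\<lambda>j. a (i, j)) m mod int p ^ m = N}) =
       (a \<in> {a \<in> space H. \<forall>x\<in>{i} \<times> {..<m}. a x \<in> X x})" by (auto simp: X_def)
    qed
    show "{a \<in> space H. zp_trunc p (\<lambda>j. a (i, j)) m mod int p ^ m = N} \<in> sets H"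
      using i by (intro sets_Collect_zp_trunc) auto
  qed (rule Xs)
  also have "\<dots> = (\<Prod>x\<in>{i} \<times> {..<m}. measure (digit_measure p) (X x))"
  proof -
    have "emeasure H {a \<in> space H. \<forall>x\<in>{i} \<times> {..<m}. a x \<in> X x} = (\<Prod>x\<in>{i} \<times> {..<m}. emeasure (digit_measure p) (X x))"
      using i by (intro D.emeasure_PiM_Collect) auto
    also have "\<dots> = ennreal (\<Prod>x\<in>{i} \<times> {..<m}. measure (digit_measure p) (X x))"
      by (simp add: measure_pmf.emeasure_eq_measure prod_ennreal)
    finally show ?thesis by (simp add: D.emeasure_eq_measure prod_nonneg)
  qed
  also have "\<dots> = (\<Prod>x\<in>{i} \<times> {..<m}. 1 / real p)"
    using p_gt_0 by (intro prod.cong) (auto simp: X_def nat_less_iff pmf_digit)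
  also have "\<dots> = 1 / real p ^ m" by (simp add: card_cartesian_product power_one_over)
  finally show ?thesis .
qed

text \<open>Split by the exact valuation \<open>3 * q + r\<close> and the unit part modulo
  \<open>p ^ 2\<close>. Each piece is a residue class modulo \<open>p ^ (3 * q + r + 2)\<close>,
  there are \<open>p * (p - 1) / \<kappa>\<close> unit parts, and the sum over \<open>q\<close> is
  geometric with ratio \<open>1 / p ^ 3\<close>.\<close>

lemma prob_has_type:
  fixes K :: "int \<Rightarrow> nat"
  assumes i: "i \<le> n" and r: "r < 3"
    and K: "\<And>u w. [u = w] (mod int p ^ 2) \<Longrightarrow> \<not> int p dvd u \<Longrightarrow> K u = K w"
    and card: "\<kappa> * card {L \<in> {0..<int p ^ 2}. \<not> int p dvd L \<and> K L = c} = p * (p - 1)" and \<kappa>: "\<kappa> > 0"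
  shows "measure H {a \<in> space H. has_type p K (\<lambda>j. a (i, j)) (r, c)}
       = (1 / real p) ^ r * ((1 - 1 / real p) / (1 - 1 / real p ^ 3)) / real \<kappa>"
proof -
  define F where "F = {L \<in> {0..<int p ^ 2}. \<not> int p dvd L \<and> K L = c}"
  have finF: "finite F" by (rule finite_subset[of _ "{0..<int p ^ 2}"]) (auto simp: F_def)
  have P: "prime (int p)" using p by simp
  define B where "B q L = {a \<in> space H. zp_trunc p (\<lambda>j. a (i, j)) (3 * q + r + 2) mod int p ^ (3 * q + r + 2)
      = int p ^ (3 * q + r) * L}" for q L
  have Bs: "B q L \<in> sets H" for q L
    unfolding B_def using i by (intro sets_Collect_zp_trunc[where Q = "\<lambda>x. x mod _ = _"]) auto
  \<comment> \<open>For \<open>L\<close> below \<open>p ^ 2\<close> this number is its own residue,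
    so \<open>B q L\<close> is both a residue event and the event of leading data
    \<open>3 * q + r\<close> and \<open>L\<close>.\<close>
  have small: "0 \<le> int p ^ (3 * q + r) * L \<and> int p ^ (3 * q + r) * L < int p ^ (3 * q + r + 2)"
    if "L \<in> F" for q L
    using that p_gt_0 unfolding power_add[of _ "3 * q + r" 2] by (auto simp: F_def)
  have B_lead: "B q L = {a \<in> space H. lead (int p) (zp_trunc p (\<lambda>j. a (i, j))) (3 * q + r) L}" if "L \<in> F" for q L
    using that small[OF that, of q] by (auto simp: B_def lead_def cong_def F_def)
  have mB: "measure H (B q L) = 1 / real p ^ (3 * q + r + 2)" if "L \<in> F" for q L
    unfolding B_def using small[OF that, of q] by (intro measure_residue i) auto
  define A where "A q = (\<Union>L\<in>F. B q L)" for q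
  have disjB: "disjoint_family_on (B q) F" for q
    unfolding disjoint_family_on_def using small P
    by (auto simp: B_def)
  have mA: "measure H (A q) = real (card F) * (1 / real p ^ (3 * q + r + 2))" for q
    unfolding A_def using Bs finF disjB mB
    by (subst D.finite_measure_finite_Union) (auto simp: image_subset_iff)
  have "disjoint_family A"
    unfolding disjoint_family_on_def
  proof (intro ballI impI)
    fix q q' :: nat assume "q \<noteq> q'"
    show "A q \<inter> A q' = {}"
    proof (rule ccontr)
      assume "A q \<inter> A q' \<noteq> {}"
      then obtain a L L' where "L \<in> F" "a \<in> B q L" "L' \<in> F" "a \<in> B q' L'" by (auto simp: A_def)
      then have "lead (int p) (zp_trunc p (\<lambda>j. a (i, j))) (3 * q + r) L"
        "lead (int p) (zp_trunc p (\<lambda>j. a (i, j))) (3 * q' + r) L'" using B_lead by auto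
      from lead_unique[OF P padic_zp_trunc this] show False using \<open>q \<noteq> q'\<close> by simp
    qed
  qed
  moreover have "range A \<subseteq> sets H" using Bs finF by (auto simp: A_def)
  ultimately have sums: "(\<lambda>q. measure H (A q)) sums measure H (\<Union>q. A q)"
    by (intro D.finite_measure_UNION)
  have un: "(\<Union>q. A q) = {a \<in> space H. has_type p K (\<lambda>j. a (i, j)) (r, c)}"
  proof (intro equalityI subsetI)
    fix a assume "a \<in> (\<Union>q. A q)"
    then obtain q L where L: "L \<in> F" "a \<in> B q L" by (auto simp: A_def)
    then have "lead (int p) (zp_trunc p (\<lambda>j. a (i, j))) (3 * q + r) L" "a \<in> space H" using B_lead by auto
    moreover have "(r, c) = ((3 * q + r) mod 3, K L)" using r L(1) by (simp add: F_def)
    ultimately show "a \<in> {a \<in> space H. has_type p K (\<lambda>j. a (i, j)) (r, c)}"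
      unfolding has_type_def by blast
  next
    fix a assume "a \<in> {a \<in> space H. has_type p K (\<lambda>j. a (i, j)) (r, c)}"
    then obtain v L where a: "a \<in> space H" and v: "lead (int p) (zp_trunc p (\<lambda>j. a (i, j))) v L"
      and rc: "r = v mod 3" "c = K L" by (auto simp: has_type_def)
    obtain w M where w: "lead (int p) (zp_trunc p (\<lambda>j. a (i, j))) w M" "0 \<le> M" "M < int p ^ 2"
      using lead_exists[OF P padic_zp_trunc lead_imp_nonzero[OF v P]] by blast
    have vw: "v = w" "[L = M] (mod int p ^ 2)" using lead_unique[OF P padic_zp_trunc v w(1)] by auto
    have "K L = K M" using K[OF vw(2)] v by (simp add: lead_def)
    then have M: "M \<in> F" using w rc by (simp add: F_def lead_def)
    have "w = 3 * (w div 3) + r" using rc(1) vw(1) by simp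
    then have "a \<in> B (w div 3) M" using B_lead[OF M, of "w div 3"] a w(1) by simp
    then show "a \<in> (\<Union>q. A q)" using M by (auto simp: A_def)
  qed
  have p1: "real p > 1" using prime_gt_1_nat[OF p] by simp
  have q3: "norm (1 / real p ^ 3) < 1" using p1 by (simp add: one_less_power)
  have "(\<lambda>q. real (card F) * (1 / real p ^ (r + 2)) * (1 / real p ^ 3) ^ q)
      sums (real (card F) * (1 / real p ^ (r + 2)) * (1 / (1 - 1 / real p ^ 3)))"
    by (intro sums_mult geometric_sums q3)
  moreover have "real (card F) * (1 / real p ^ (r + 2)) * (1 / real p ^ 3) ^ q = measure H (A q)" for q
    unfolding mA by (simp add: power_add power_mult power_one_over)
  ultimately have "measure H (\<Union>q. A q) = real (card F) * (1 / real p ^ (r + 2)) * (1 / (1 - 1 / real p ^ 3))"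
    using sums sums_unique2 by simp
  also have "real (card F) = real p * (real p - 1) / real \<kappa>"
  proof -
    have "real (\<kappa> * card F) = real (p * (p - 1))" unfolding F_def card by simp
    then have "real \<kappa> * real (card F) = real p * (real p - 1)" using p1 by (simp add: of_nat_diff)
    then show ?thesis using \<kappa> by (simp add: field_simps)
  qed
  also have "real p * (real p - 1) / real \<kappa> * (1 / real p ^ (r + 2)) * (1 / (1 - 1 / real p ^ 3))
      = (1 / real p) ^ r * ((1 - 1 / real p) / (1 - 1 / real p ^ 3)) / real \<kappa>"
  proof -
    have "real p * (real p - 1) * (1 / real p ^ (r + 2)) = (1 / real p) ^ r * (1 - 1 / real p)"
      using p1 by (simp add: field_simps power_add power2_eq_square)
    moreover have "x / real \<kappa> * y * (1 / z) = a * (b / z) / real \<kappa>" if "x * y = a * b" for x y z a b :: real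
      using that by simp
    ultimately show ?thesis by blast
  qed
  finally show ?thesis unfolding un .
qed

text \<open>The type of a coefficient depends only on its own row of digits, and the rows are
  disjoint blocks of independent digits.\<close>

lemma indep_has_type:
  "measure H {a \<in> space H. \<forall>i\<le>n. has_type p K (\<lambda>j. a (i, j)) (t i)}
     = (\<Prod>i\<le>n. measure H {a \<in> space H. has_type p K (\<lambda>j. a (i, j)) (t i)})"
proof -
  let ?N = "\<lambda>_ :: nat \<times> nat. digit_measure p"
  let ?I = "{..n} \<times> (UNIV :: nat set)"
  \<comment> \<open>The joint law of the digits is \<open>H\<close> itself, which is the product of
    its marginals.\<close>
  have ind: "D.indep_vars ?N (\<lambda>x a. a x) ?I"
  proof (subst D.indep_vars_iff_distr_eq_PiM')
    have "distr H H (\<lambda>a. \<lambda>x\<in>?I. a x) = distr H H (\<lambda>a. a)"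
      by (intro distr_cong) (auto simp: space_PiM PiE_restrict)
    also have "\<dots> = H" by simp
    also have "H = PiM ?I (\<lambda>x. distr H (digit_measure p) (\<lambda>a. a x))"
      by (intro PiM_cong refl distr_PiM_component[symmetric]) (auto intro: measure_pmf.prob_space_axioms)
    finally show "distr H H (\<lambda>a. \<lambda>x\<in>?I. a x) = PiM ?I (\<lambda>x. distr H (digit_measure p) (\<lambda>a. a x))" .
  qed auto
  define J where "J i = {i} \<times> (UNIV :: nat set)" for i :: nat
  have indJ: "D.indep_vars (\<lambda>i. PiM (J i) ?N) (\<lambda>i a. restrict a (J i)) {..n}"
    using D.indep_vars_restrict[OF ind, of "{..n}" J] by (auto simp: J_def disjoint_family_on_def)
  define A where "A i = {a \<in> space (PiM (J i) ?N). has_type p K (\<lambda>j. a (i, j)) (t i)}" for i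
  have A: "A i \<in> sets (PiM (J i) ?N)" for i
    unfolding A_def by (rule sets_Collect_has_type) (simp add: J_def)
  have pre: "(\<lambda>a. restrict a (J i)) -` A i \<inter> space H = {a \<in> space H. has_type p K (\<lambda>j. a (i, j)) (t i)}" if "i \<le> n" for i
    using that by (auto simp: A_def space_PiM J_def)
  have "{a \<in> space H. \<forall>i\<le>n. has_type p K (\<lambda>j. a (i, j)) (t i)}
      = (\<Inter>i\<in>{..n}. (\<lambda>a. restrict a (J i)) -` A i \<inter> space H)"
    using pre by auto
  then have "measure H {a \<in> space H. \<forall>i\<le>n. has_type p K (\<lambda>j. a (i, j)) (t i)}
      = (\<Prod>i\<le>n. measure H ((\<lambda>a. restrict a (J i)) -` A i \<inter> space H))"
    using D.indep_varsD_finite[OF indJ, of A] A by simp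
  also have "\<dots> = (\<Prod>i\<le>n. measure H {a \<in> space H. has_type p K (\<lambda>j. a (i, j)) (t i)})"
    by (intro prod.cong) (simp_all add: pre)
  finally show ?thesis .
qed

end

text \<open>The probability that the valuation is congruent to \<open>r\<close> modulo 3, for
  \<open>r < 3\<close>; dividing by \<open>\<kappa>\<close> gives that of a single type.\<close>

definition type_weight :: "nat \<Rightarrow> nat \<Rightarrow> real" where
  "type_weight p r = (1 / real p) ^ r * ((1 - 1 / real p) / (1 - 1 / real p ^ 3))"

section \<open>From ordered types to sets of types\<close>

definition fibre_count :: "(nat \<times> nat) set \<Rightarrow> nat \<Rightarrow> nat" where
  "fibre_count S r = card {c. (r, c) \<in> S}"

lemma index_count_eq_fibre_count:
  assumes inj: "inj_on \<tau> {..n}" and im: "\<And>i. i \<le> n \<Longrightarrow> fst (\<tau> i) < 3"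
  shows "index_count n (\<lambda>i. fst (\<tau> i)) = fibre_count (\<tau> ` {..n})"
proof
  fix r
  have "{i. i \<le> n \<and> fst (\<tau> i) mod 3 = r} = {i. i \<le> n \<and> fst (\<tau> i) = r}" using im by auto
  then have "index_count n (\<lambda>i. fst (\<tau> i)) r = card {i. i \<le> n \<and> fst (\<tau> i) = r}"
    by (simp add: index_count_def)
  also have "\<dots> = card (\<tau> ` {i. i \<le> n \<and> fst (\<tau> i) = r})"
    by (intro card_image[symmetric] inj_on_subset[OF inj]) auto
  also have "\<tau> ` {i. i \<le> n \<and> fst (\<tau> i) = r} = Pair r ` {c. (r, c) \<in> \<tau> ` {..n}}"
  proof (intro equalityI subsetI)
    fix x assume "x \<in> \<tau> ` {i. i \<le> n \<and> fst (\<tau> i) = r}"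
    then obtain i where i: "i \<le> n" "fst (\<tau> i) = r" "x = \<tau> i" by blast
    then have "x = (r, snd (\<tau> i))" by (metis prod.collapse)
    moreover have "(r, snd (\<tau> i)) \<in> \<tau> ` {..n}" using i by (metis atMost_iff imageI prod.collapse)
    ultimately show "x \<in> Pair r ` {c. (r, c) \<in> \<tau> ` {..n}}" by blast
  next
    fix x assume "x \<in> Pair r ` {c. (r, c) \<in> \<tau> ` {..n}}"
    then obtain c i where "x = (r, c)" "i \<le> n" "(r, c) = \<tau> i" by auto
    then show "x \<in> \<tau> ` {i. i \<le> n \<and> fst (\<tau> i) = r}" by (metis (mono_tags) fst_conv imageI mem_Collect_eq)
  qed
  also have "card \<dots> = fibre_count (\<tau> ` {..n}) r"
    unfolding fibre_count_def by (intro card_image) (simp add: inj_on_def)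
  finally show "index_count n (\<lambda>i. fst (\<tau> i)) r = fibre_count (\<tau> ` {..n}) r" .
qed

text \<open>The product depends only on the image, and each set of \<open>Suc n\<close> types is the
  image of \<open>(n + 1)!\<close> injections.\<close>

lemma sum_inj_functions:
  fixes w :: "'a \<Rightarrow> real"
  assumes "finite T"
  shows "(\<Sum>\<tau> | \<tau> \<in> {..n} \<rightarrow>\<^sub>E T \<and> inj_on \<tau> {..n} \<and> Q (\<tau> ` {..n}). \<Prod>i\<le>n. w (\<tau> i))
    = fact (Suc n) * (\<Sum>S | S \<subseteq> T \<and> card S = Suc n \<and> Q S. \<Prod>x\<in>S. w x)"
proof -
  define B where "B = {\<tau>. \<tau> \<in> {..n} \<rightarrow>\<^sub>E T \<and> inj_on \<tau> {..n} \<and> Q (\<tau> ` {..n})}"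
  define C where "C = {S. S \<subseteq> T \<and> card S = Suc n \<and> Q S}"
  have finB: "finite B"
    by (rule finite_subset[of _ "{..n} \<rightarrow>\<^sub>E T"]) (auto simp: B_def assms intro: finite_PiE)
  have finC: "finite C" by (rule finite_subset[of _ "Pow T"]) (auto simp: C_def assms)
  have "(\<lambda>\<tau>. \<tau> ` {..n}) ` B \<subseteq> C"
    by (auto simp: B_def C_def card_image PiE_iff)
  from sum.group[OF finB finC this, of "\<lambda>\<tau>. \<Prod>i\<le>n. w (\<tau> i)"]
  have "(\<Sum>\<tau>\<in>B. \<Prod>i\<le>n. w (\<tau> i)) = (\<Sum>S\<in>C. \<Sum>\<tau> | \<tau> \<in> B \<and> \<tau> ` {..n} = S. \<Prod>i\<le>n. w (\<tau> i))" by simp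
  also have "\<dots> = (\<Sum>S\<in>C. fact (Suc n) * (\<Prod>x\<in>S. w x))"
  proof (rule sum.cong[OF refl])
    fix S assume S: "S \<in> C"
    have finS: "finite S" using S assms finite_subset by (auto simp: C_def)
    have eq: "{\<tau>. \<tau> \<in> B \<and> \<tau> ` {..n} = S} = {\<tau> \<in> {..n} \<rightarrow>\<^sub>E S. inj_on \<tau> {..n}}"
    proof (intro equalityI subsetI)
      fix \<tau> assume "\<tau> \<in> {\<tau>. \<tau> \<in> B \<and> \<tau> ` {..n} = S}"
      then show "\<tau> \<in> {\<tau> \<in> {..n} \<rightarrow>\<^sub>E S. inj_on \<tau> {..n}}" by (auto simp: B_def PiE_iff)
    next
      fix \<tau> assume \<tau>: "\<tau> \<in> {\<tau> \<in> {..n} \<rightarrow>\<^sub>E S. inj_on \<tau> {..n}}"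
      then have "\<tau> ` {..n} \<subseteq> S" "card (\<tau> ` {..n}) = Suc n" by (auto simp: card_image)
      then have "\<tau> ` {..n} = S" using finS S by (intro card_subset_eq) (auto simp: C_def)
      then show "\<tau> \<in> {\<tau>. \<tau> \<in> B \<and> \<tau> ` {..n} = S}" using \<tau> S by (auto simp: B_def C_def PiE_iff)
    qed
    have "(\<Sum>\<tau> | \<tau> \<in> B \<and> \<tau> ` {..n} = S. \<Prod>i\<le>n. w (\<tau> i)) = (\<Sum>\<tau> | \<tau> \<in> B \<and> \<tau> ` {..n} = S. \<Prod>x\<in>S. w x)"
    proof (rule sum.cong[OF refl])
      fix \<tau> assume "\<tau> \<in> {\<tau>. \<tau> \<in> B \<and> \<tau> ` {..n} = S}"
      then have "inj_on \<tau> {..n}" "S = \<tau> ` {..n}" by (auto simp: B_def)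
      then show "(\<Prod>i\<le>n. w (\<tau> i)) = (\<Prod>x\<in>S. w x)" by (simp add: prod.reindex)
    qed
    also have "\<dots> = real (card {\<tau> \<in> {..n} \<rightarrow>\<^sub>E S. inj_on \<tau> {..n}}) * (\<Prod>x\<in>S. w x)" unfolding eq by simp
    also have "card {\<tau> \<in> {..n} \<rightarrow>\<^sub>E S. inj_on \<tau> {..n}} = fact (Suc n)"
    proof -
      have "card {\<tau> \<in> {..n} \<rightarrow>\<^sub>E S. inj_on \<tau> {..n}} = (\<Prod>i = 0..<Suc n. Suc n - i)"
        using card_inj_on_subset_funcset[of "{..n}" S "{..n}"] finS S by (simp add: C_def)
      also have "\<dots> = fact (Suc n)" by (simp only: fact_prod_rev of_nat_id)
      finally show ?thesis .
    qed
    finally show "(\<Sum>\<tau> | \<tau> \<in> B \<and> \<tau> ` {..n} = S. \<Prod>i\<le>n. w (\<tau> i)) = fact (Suc n) * (\<Prod>x\<in>S. w x)"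
      by (simp only: of_nat_fact)
  qed
  finally show ?thesis unfolding B_def C_def by (simp add: sum_distrib_left)
qed

lemma sum_Pow_card:
  fixes f :: "nat \<Rightarrow> real"
  assumes "finite A"
  shows "(\<Sum>X\<in>Pow A. f (card X)) = (\<Sum>m\<le>card A. real (card A choose m) * f m)"
proof -
  have "card ` Pow A \<subseteq> {..card A}" using assms by (auto intro: card_mono)
  from sum.group[OF _ _ this, of "\<lambda>X. f (card X)"] assms
  have "(\<Sum>X\<in>Pow A. f (card X)) = (\<Sum>m\<le>card A. \<Sum>X | X \<in> Pow A \<and> card X = m. f (card X))" by simp
  also have "\<dots> = (\<Sum>m\<le>card A. real (card A choose m) * f m)"
  proof (rule sum.cong[OF refl])
    fix m
    have "(\<Sum>X | X \<in> Pow A \<and> card X = m. f (card X)) = (\<Sum>X | X \<in> Pow A \<and> card X = m. f m)"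
      by (rule sum.cong) auto
    also have "\<dots> = real (card {X. X \<subseteq> A \<and> card X = m}) * f m" by simp
    finally show "(\<Sum>X | X \<in> Pow A \<and> card X = m. f (card X)) = real (card A choose m) * f m"
      using n_subsets[OF assms] by simp
  qed
  finally show ?thesis .
qed

text \<open>The three level sizes as a function on all of \<open>nat\<close>, so that it can equal
  \<open>fibre_count S\<close> and be an argument of a criterion \<open>G\<close>.\<close>

definition triple_fun :: "nat \<Rightarrow> nat \<Rightarrow> nat \<Rightarrow> nat \<Rightarrow> nat" where
  "triple_fun a b c r = (if r = 0 then a else if r = 1 then b else if r = 2 then c else 0)"

text \<open>A set of types amounts to three arbitrary sets of classes, one per level, and the
  criterion and the weight see only their sizes. The nested form comes from summing over subsets by
  size three times.\<close>

lemma sum_type_sets: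
  fixes w :: "nat \<Rightarrow> real"
  shows "(\<Sum>S | S \<subseteq> {..<3} \<times> {..<\<kappa>} \<and> card S = m \<and> G (fibre_count S). \<Prod>x\<in>S. w (fst x))
    = (\<Sum>a\<le>\<kappa>. \<Sum>b\<le>\<kappa>. \<Sum>c\<le>\<kappa>. real (\<kappa> choose a) * (real (\<kappa> choose b) * (real (\<kappa> choose c) *
        (if a + b + c = m \<and> G (triple_fun a b c) then w 0 ^ a * w 1 ^ b * w 2 ^ c else 0))))"
proof -
  define T where "T = {..<3 :: nat} \<times> {..<\<kappa>}"
  define fib where "fib S r = {c. (r, c) \<in> S}" for S :: "(nat \<times> nat) set" and r
  define join where "join A B C = Pair (0 :: nat) ` A \<union> Pair 1 ` B \<union> Pair 2 ` C" for A B C :: "nat set"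
  define f where "f a b c = (if a + b + c = m \<and> G (triple_fun a b c) then w 0 ^ a * w 1 ^ b * w 2 ^ c else 0)"
    for a b c
  have lt3: "x = 0 \<or> x = 1 \<or> x = 2" if "x < 3" for x :: nat using that by linarith
  have join_fib: "join (fib S 0) (fib S 1) (fib S 2) = S" if "S \<in> Pow T" for S
  proof (intro equalityI subsetI)
    fix x assume x: "x \<in> S"
    obtain r c where rc: "x = (r, c)" by (cases x)
    then have "r = 0 \<or> r = 1 \<or> r = 2" using x that by (intro lt3) (auto simp: T_def)
    then show "x \<in> join (fib S 0) (fib S 1) (fib S 2)"
      using x rc by (elim disjE) (simp_all add: join_def fib_def)
  qed (auto simp: join_def fib_def)
  have val: "(if card S = m \<and> G (fibre_count S) then \<Prod>x\<in>S. w (fst x) else 0)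
      = f (card (fib S 0)) (card (fib S 1)) (card (fib S 2))" if "S \<in> Pow T" for S
  proof -
    have S: "S = Pair 0 ` fib S 0 \<union> (Pair 1 ` fib S 1 \<union> Pair 2 ` fib S 2)"
      using join_fib[OF that] by (simp add: join_def Un_assoc)
    have fin: "finite (fib S r)" for r
      by (rule finite_subset[of _ "{..<\<kappa>}"]) (use that in \<open>auto simp: fib_def T_def\<close>)
    have cardS: "card S = card (fib S 0) + card (fib S 1) + card (fib S 2)"
      by (subst S, subst card_Un_disjoint, (auto simp: fin)[3], subst card_Un_disjoint)
         (auto simp: fin card_image inj_on_def)
    have "fibre_count S = triple_fun (card (fib S 0)) (card (fib S 1)) (card (fib S 2))"
    proof
      fix r
      have "{c. (r, c) \<in> S} = {}" if "\<not> r < 3" using \<open>S \<in> Pow T\<close> that by (auto simp: T_def)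
      then show "fibre_count S r = triple_fun (card (fib S 0)) (card (fib S 1)) (card (fib S 2)) r"
        using lt3[of r] by (auto simp: fibre_count_def triple_fun_def fib_def)
    qed
    moreover have "(\<Prod>x\<in>S. w (fst x)) = w 0 ^ card (fib S 0) * w 1 ^ card (fib S 1) * w 2 ^ card (fib S 2)"
    proof -
      have "(\<Prod>x\<in>S. w (fst x)) = (\<Prod>x\<in>Pair 0 ` fib S 0. w (fst x)) * ((\<Prod>x\<in>Pair 1 ` fib S 1. w (fst x)) * (\<Prod>x\<in>Pair 2 ` fib S 2. w (fst x)))"
        by (subst S, subst prod.union_disjoint, (auto simp: fin)[3], subst prod.union_disjoint)
           (auto simp: fin)
      then show ?thesis by (simp add: prod.reindex inj_on_def)
    qed
    ultimately show ?thesis unfolding f_def cardS by simp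
  qed
  have finT: "finite T" by (simp add: T_def)
  have "(\<Sum>S | S \<subseteq> T \<and> card S = m \<and> G (fibre_count S). \<Prod>x\<in>S. w (fst x))
      = (\<Sum>S\<in>Pow T. if card S = m \<and> G (fibre_count S) then \<Prod>x\<in>S. w (fst x) else 0)"
    by (rule sum.mono_neutral_cong_left) (auto simp: finT)
  also have "\<dots> = (\<Sum>S\<in>Pow T. f (card (fib S 0)) (card (fib S 1)) (card (fib S 2)))"
    by (rule sum.cong[OF refl val])
  also have "\<dots> = (\<Sum>(A, B, C)\<in>Pow {..<\<kappa>} \<times> Pow {..<\<kappa>} \<times> Pow {..<\<kappa>}. f (card A) (card B) (card C))"
  proof (rule sum.reindex_bij_witness[where i = "\<lambda>(A, B, C). join A B C" and j = "\<lambda>S. (fib S 0, fib S 1, fib S 2)"])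
    fix S assume "S \<in> Pow T"
    then show "(case (fib S 0, fib S 1, fib S 2) of (A, B, C) \<Rightarrow> join A B C) = S"
      using join_fib by simp
    show "(fib S 0, fib S 1, fib S 2) \<in> Pow {..<\<kappa>} \<times> Pow {..<\<kappa>} \<times> Pow {..<\<kappa>}"
      using \<open>S \<in> Pow T\<close> by (auto simp: fib_def T_def)
  qed (auto simp: join_def fib_def T_def)
  also have "\<dots> = (\<Sum>A\<in>Pow {..<\<kappa>}. \<Sum>B\<in>Pow {..<\<kappa>}. \<Sum>C\<in>Pow {..<\<kappa>}. f (card A) (card B) (card C))"
    by (simp add: sum.cartesian_product)
  also have "\<dots> = (\<Sum>A\<in>Pow {..<\<kappa>}. \<Sum>B\<in>Pow {..<\<kappa>}. \<Sum>c\<le>\<kappa>. real (\<kappa> choose c) * f (card A) (card B) c)"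
    by (simp only: sum_Pow_card finite_lessThan card_lessThan)
  also have "\<dots> = (\<Sum>A\<in>Pow {..<\<kappa>}. \<Sum>b\<le>\<kappa>. real (\<kappa> choose b) * (\<Sum>c\<le>\<kappa>. real (\<kappa> choose c) * f (card A) b c))"
    by (simp only: sum_Pow_card[where f = "\<lambda>b. \<Sum>c\<le>\<kappa>. real (\<kappa> choose c) * f _ b c"] finite_lessThan card_lessThan)
  also have "\<dots> = (\<Sum>a\<le>\<kappa>. real (\<kappa> choose a) * (\<Sum>b\<le>\<kappa>. real (\<kappa> choose b) * (\<Sum>c\<le>\<kappa>. real (\<kappa> choose c) * f a b c)))"
    by (simp only: sum_Pow_card[where f = "\<lambda>a. \<Sum>b\<le>\<kappa>. real (\<kappa> choose b) * (\<Sum>c\<le>\<kappa>. real (\<kappa> choose c) * f a b c)"] finite_lessThan card_lessThan)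
  finally show ?thesis unfolding T_def f_def by (simp only: sum_distrib_left)
qed

section \<open>The density as a finite sum over insoluble types\<close>

context cube_classes
begin

lemma \<kappa>_pos: "\<kappa> > 0"
  using K_less[of 1] prime_gt_1_nat[OF prime_p] by fastforce

text \<open>\<open>char\<close> isolates what the arithmetic of each prime has to supply: a
  criterion \<open>G\<close> on level sizes. The insoluble set then splits into disjoint events, one
  per bad assignment of types, and independence turns each probability into a product.\<close>

lemma rho_eq_sum_bad_types:
  assumes char: "\<forall>v L. (\<forall>i\<le>n. \<not> int p dvd L i) \<longrightarrow> (\<not> reduced_zero (int p) e n v L \<longleftrightarrow>
     inj_on (\<lambda>i. (v i mod 3, K (L i))) {..n} \<and> G (index_count n v))"
  shows "rho p n 3 = 1 - (\<Sum>\<tau> | \<tau> \<in> {..n} \<rightarrow>\<^sub>E {..<3} \<times> {..<\<kappa>} \<and> inj_on \<tau> {..n} \<and>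
      G (fibre_count (\<tau> ` {..n})). \<Prod>i\<le>n. type_weight p (fst (\<tau> i)) / real \<kappa>)"
proof -
  interpret haar_digits p n by unfold_locales (rule prime_p)
  have P: "prime (int p)" using prime_p by simp
  have K2: "K u = K w" if "[u = w] (mod int p ^ 2)" "\<not> int p dvd u" for u w
    using that(1) three(3) by (intro K_cong that(2) cong_dvd_modulus[OF that(1)] le_imp_power_dvd) simp
  define B where "B = {\<tau>. \<tau> \<in> {..n} \<rightarrow>\<^sub>E {..<3} \<times> {..<\<kappa>} \<and> inj_on \<tau> {..n} \<and> G (fibre_count (\<tau> ` {..n}))}"
  have finB: "finite B"
    by (rule finite_subset[of _ "{..n} \<rightarrow>\<^sub>E {..<3} \<times> {..<\<kappa>}"]) (auto simp: B_def intro: finite_PiE)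
  define E where "E \<tau> = {a \<in> space H. \<forall>i\<le>n. has_type p K (\<lambda>j. a (i, j)) (\<tau> i)}" for \<tau>
  have Es: "E \<tau> \<in> sets H" for \<tau>
  proof -
    have "{a \<in> space H. \<forall>i\<in>{..n}. has_type p K (\<lambda>j. a (i, j)) (\<tau> i)} \<in> sets H"
      by (intro sets.sets_Collect_finite_All sets_Collect_has_type) auto
    then show ?thesis unfolding E_def by (simp only: Ball_def atMost_iff)
  qed
  have mE: "measure H (E \<tau>) = (\<Prod>i\<le>n. type_weight p (fst (\<tau> i)) / real \<kappa>)" if "\<tau> \<in> B" for \<tau>
  proof -
    have "measure H {a \<in> space H. has_type p K (\<lambda>j. a (i, j)) (\<tau> i)} = type_weight p (fst (\<tau> i)) / real \<kappa>"
      if i: "i \<in> {..n}" for i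
    proof -
      have "\<tau> \<in> {..n} \<rightarrow>\<^sub>E {..<3} \<times> {..<\<kappa>}" using \<open>\<tau> \<in> B\<close> by (simp add: B_def)
      then have "\<tau> i \<in> {..<3} \<times> {..<\<kappa>}" using i by (rule PiE_mem)
      then obtain r c where t: "\<tau> i = (r, c)" "r < 3" "c < \<kappa>" by auto
      have "i \<le> n" using i by simp
      from prob_has_type[OF this t(2) _ card_K[OF t(3)] \<kappa>_pos] K2
      show ?thesis by (simp add: t(1) type_weight_def)
    qed
    then show ?thesis
      unfolding E_def by (subst indep_has_type) (rule prod.cong[OF refl])
  qed
  have disj: "disjoint_family_on E B"
    unfolding disjoint_family_on_def
  proof (intro ballI impI)
    fix \<tau> \<sigma> assume B: "\<tau> \<in> B" "\<sigma> \<in> B" "\<tau> \<noteq> \<sigma>"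
    show "E \<tau> \<inter> E \<sigma> = {}"
    proof (rule ccontr)
      assume "E \<tau> \<inter> E \<sigma> \<noteq> {}"
      then obtain a where "\<forall>i\<le>n. has_type p K (\<lambda>j. a (i, j)) (\<tau> i) \<and> has_type p K (\<lambda>j. a (i, j)) (\<sigma> i)"
        by (auto simp: E_def)
      then have "\<tau> i = \<sigma> i" if "i \<le> n" for i using that has_type_unique[where K = K, OF prime_p K2] by blast
      then have "\<tau> = \<sigma>" using B(1,2) by (intro PiE_ext[of \<tau> "{..n}" "\<lambda>_. {..<3} \<times> {..<\<kappa>}" \<sigma>]) (auto simp: B_def)
      then show False using B(3) by simp
    qed
  qed
  have compl: "{a \<in> space H. \<not> diag_Qp_point p n 3 a} = (\<Union>\<tau>\<in>B. E \<tau>)"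
  proof (intro equalityI subsetI)
    fix a assume "a \<in> {a \<in> space H. \<not> diag_Qp_point p n 3 a}"
    then have a: "a \<in> space H" "\<not> diag_Qp_point p n 3 a" by auto
    have "\<exists>v L. lead (int p) (zp_trunc p (\<lambda>j. a (i, j))) v L" if i: "i \<le> n" for i
    proof -
      obtain m where "\<not> int p ^ m dvd zp_trunc p (\<lambda>j. a (i, j)) m"
        using diag_Qp_point_if_zero_coeff[OF prime_p i] a(2) by (metis zero_less_numeral)
      then show ?thesis by (rule lead_exists[OF P padic_zp_trunc]) blast
    qed
    then obtain v L where vL: "\<And>i. i \<le> n \<Longrightarrow> lead (int p) (zp_trunc p (\<lambda>j. a (i, j))) (v i) (L i)" by metis
    then have nd: "\<And>i. i \<le> n \<Longrightarrow> \<not> int p dvd L i" by (simp add: lead_def)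
    have iff: "\<not> reduced_zero (int p) e n v L \<longleftrightarrow>
        inj_on (\<lambda>i. (v i mod 3, K (L i))) {..n} \<and> G (index_count n v)"
      by (rule char[rule_format]) (rule nd)
    have "\<not> reduced_zero (int p) e n v L"
      using reduced_zero_imp_diag_Qp_point[where v = v and L = L and a = a, OF prime_p three vL] a(2) by blast
    then have c: "inj_on (\<lambda>i. (v i mod 3, K (L i))) {..n}" "G (index_count n v)" using iff by auto
    \<comment> \<open>Restriction to \<open>{..n}\<close> makes the assignment extensional, hence a
      member of the finite set \<open>B\<close>.\<close>
    define \<tau> where "\<tau> = (\<lambda>i\<in>{..n}. (v i mod 3, K (L i)))"
    have inj: "inj_on \<tau> {..n}" using c(1) by (simp add: \<tau>_def inj_on_def)
    have "index_count n v = index_count n (\<lambda>i. fst (\<tau> i))"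
      unfolding index_count_def fun_eq_iff by (auto simp: \<tau>_def intro!: arg_cong[where f = card])
    also have "\<dots> = fibre_count (\<tau> ` {..n})" by (rule index_count_eq_fibre_count[OF inj]) (simp add: \<tau>_def)
    finally have "G (fibre_count (\<tau> ` {..n}))" using c(2) by simp
    moreover have "\<tau> \<in> {..n} \<rightarrow>\<^sub>E {..<3} \<times> {..<\<kappa>}" using K_less nd by (auto simp: \<tau>_def)
    ultimately have "\<tau> \<in> B" using inj by (simp add: B_def)
    moreover have "a \<in> E \<tau>" using a(1) vL by (auto simp: E_def \<tau>_def has_type_def)
    ultimately show "a \<in> (\<Union>\<tau>\<in>B. E \<tau>)" by blast
  next
    fix a assume "a \<in> (\<Union>\<tau>\<in>B. E \<tau>)"
    then obtain \<tau> where \<tau>: "\<tau> \<in> B" "a \<in> E \<tau>" by blast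
    then have "\<forall>i. \<exists>v L. i \<le> n \<longrightarrow> lead (int p) (zp_trunc p (\<lambda>j. a (i, j))) v L \<and> \<tau> i = (v mod 3, K L)"
      by (auto simp: E_def has_type_def)
    then obtain v L where vL: "\<And>i. i \<le> n \<Longrightarrow> lead (int p) (zp_trunc p (\<lambda>j. a (i, j))) (v i) (L i)"
      "\<And>i. i \<le> n \<Longrightarrow> \<tau> i = (v i mod 3, K (L i))" by metis
    then have nd: "\<And>i. i \<le> n \<Longrightarrow> \<not> int p dvd L i" by (simp add: lead_def)
    have iff: "\<not> reduced_zero (int p) e n v L \<longleftrightarrow>
        inj_on (\<lambda>i. (v i mod 3, K (L i))) {..n} \<and> G (index_count n v)"
      by (rule char[rule_format]) (rule nd)
    have inj: "inj_on \<tau> {..n}" using \<tau>(1) by (simp add: B_def)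
    then have inj': "inj_on (\<lambda>i. (v i mod 3, K (L i))) {..n}" using vL(2) by (simp add: inj_on_def)
    have "index_count n v = index_count n (\<lambda>i. fst (\<tau> i))"
      unfolding index_count_def fun_eq_iff using vL(2) by (auto intro!: arg_cong[where f = card])
    also have "\<dots> = fibre_count (\<tau> ` {..n})" by (rule index_count_eq_fibre_count[OF inj]) (simp add: vL(2))
    finally have "G (index_count n v)" using \<tau>(1) by (simp add: B_def)
    then have "\<not> reduced_zero (int p) e n v L" using iff inj' by blast
    then have "\<not> diag_Qp_point p n 3 a"
      using diag_Qp_point_imp_reduced_zero[where v = v and L = L and a = a, OF prime_p three(3) vL(1)] by blast
    then show "a \<in> {a \<in> space H. \<not> diag_Qp_point p n 3 a}" using \<tau>(2) by (simp add: E_def)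
  qed
  have "{a \<in> space H. diag_Qp_point p n 3 a} = space H - (\<Union>\<tau>\<in>B. E \<tau>)"
    unfolding compl[symmetric] by blast
  then have "rho p n 3 = measure H (space H - (\<Union>\<tau>\<in>B. E \<tau>))"
    by (simp add: rho_def haar_Zp_vec_def)
  also have "\<dots> = 1 - measure H (\<Union>\<tau>\<in>B. E \<tau>)"
    using Es finB by (intro D.prob_compl) auto
  also have "measure H (\<Union>\<tau>\<in>B. E \<tau>) = (\<Sum>\<tau>\<in>B. measure H (E \<tau>))"
    using Es finB disj by (intro D.finite_measure_finite_Union) auto
  also have "\<dots> = (\<Sum>\<tau>\<in>B. \<Prod>i\<le>n. type_weight p (fst (\<tau> i)) / real \<kappa>)"
    by (rule sum.cong[OF refl mE])
  finally show ?thesis unfolding B_def .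
qed

lemma rho_eq:
  assumes char: "\<forall>v L. (\<forall>i\<le>n. \<not> int p dvd L i) \<longrightarrow> (\<not> reduced_zero (int p) e n v L \<longleftrightarrow>
     inj_on (\<lambda>i. (v i mod 3, K (L i))) {..n} \<and> G (index_count n v))"
  shows "rho p n 3 = 1 - fact (Suc n) *
    (\<Sum>a\<le>\<kappa>. \<Sum>b\<le>\<kappa>. \<Sum>c\<le>\<kappa>. real (\<kappa> choose a) * (real (\<kappa> choose b) * (real (\<kappa> choose c) *
        (if a + b + c = Suc n \<and> G (triple_fun a b c)
         then (type_weight p 0 / \<kappa>) ^ a * (type_weight p 1 / \<kappa>) ^ b * (type_weight p 2 / \<kappa>) ^ c else 0))))"
proof -
  have "(\<Sum>\<tau> | \<tau> \<in> {..n} \<rightarrow>\<^sub>E {..<3} \<times> {..<\<kappa>} \<and> inj_on \<tau> {..n} \<and>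
      G (fibre_count (\<tau> ` {..n})). \<Prod>i\<le>n. type_weight p (fst (\<tau> i)) / real \<kappa>)
    = fact (Suc n) * (\<Sum>S | S \<subseteq> {..<3} \<times> {..<\<kappa>} \<and> card S = Suc n \<and> G (fibre_count S).
        \<Prod>x\<in>S. type_weight p (fst x) / real \<kappa>)"
    by (rule sum_inj_functions[where w = "\<lambda>x. type_weight p (fst x) / real \<kappa>" and Q = "\<lambda>S. G (fibre_count S)"]) simp
  moreover have "rho p n 3 = 1 - (\<Sum>\<tau> | \<tau> \<in> {..n} \<rightarrow>\<^sub>E {..<3} \<times> {..<\<kappa>} \<and> inj_on \<tau> {..n} \<and>
      G (fibre_count (\<tau> ` {..n})). \<Prod>i\<le>n. type_weight p (fst (\<tau> i)) / real \<kappa>)"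
    by (rule rho_eq_sum_bad_types[OF char])
  ultimately show ?thesis
    by (simp only: sum_type_sets[where w = "\<lambda>r. type_weight p r / real \<kappa>"])
qed

text \<open>All summands vanish as soon as admissible level sizes cannot add up to the
  \<open>n + 1\<close> coefficients.\<close>

lemma rho_eq_1:
  assumes char: "\<forall>v L. (\<forall>i\<le>n. \<not> int p dvd L i) \<longrightarrow> (\<not> reduced_zero (int p) e n v L \<longleftrightarrow>
     inj_on (\<lambda>i. (v i mod 3, K (L i))) {..n} \<and> G (index_count n v))"
    and small: "\<And>a b c. \<lbrakk>a \<le> \<kappa>; b \<le> \<kappa>; c \<le> \<kappa>; G (triple_fun a b c)\<rbrakk> \<Longrightarrow> a + b + c \<le> n"
  shows "rho p n 3 = 1"
proof -
  have "(\<Sum>a\<le>\<kappa>. \<Sum>b\<le>\<kappa>. \<Sum>c\<le>\<kappa>. real (\<kappa> choose a) * (real (\<kappa> choose b) * (real (\<kappa> choose c) *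
        (if a + b + c = Suc n \<and> G (triple_fun a b c)
         then (type_weight p 0 / \<kappa>) ^ a * (type_weight p 1 / \<kappa>) ^ b * (type_weight p 2 / \<kappa>) ^ c else 0)))) = 0"
    using small by (intro sum.neutral ballI) fastforce
  with rho_eq[OF char] show ?thesis by simp
qed

end

section \<open>The densities\<close>

lemma all_less_3: "(\<forall>r<3. Q r) \<longleftrightarrow> Q 0 \<and> Q 1 \<and> Q (2::nat)"
proof -
  have "{r::nat. r < 3} = {0, 1, 2}" by auto
  then show ?thesis by (metis (mono_tags) insertE insertI1 insertI2 mem_Collect_eq singletonD)
qed

lemma sum_atMost_3: "(\<Sum>k\<le>3. f k) = f 0 + f 1 + f 2 + (f (3::nat) :: real)"
  by (simp add: numeral_3_eq_3 numeral_2_eq_2)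

lemma choose_3: "3 choose 0 = (1::nat)" "3 choose 1 = (3::nat)" "3 choose 2 = (3::nat)" "3 choose 3 = (1::nat)"
  by (simp_all add: numeral_3_eq_3 numeral_2_eq_2)

lemma rho_2_mod_3:
  assumes p: "prime p" "p mod 3 = 2"
  shows "rho p 2 3 = 1 - 6 * (type_weight p 0 * type_weight p 1 * type_weight p 2)"
    and "n \<ge> 3 \<Longrightarrow> rho p n 3 = 1"
proof -
  interpret cube_classes p 0 1 3 "\<lambda>_. 0" by (rule cube_classes_2_mod_3[OF p])
  have char: "\<forall>v L. (\<forall>i\<le>n. \<not> int p dvd L i) \<longrightarrow> (\<not> reduced_zero (int p) 0 n v L \<longleftrightarrow>
     inj_on (\<lambda>i. (v i mod 3, 0 :: nat)) {..n} \<and> True)" for n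
    using not_reduced_zero_iff_2_mod_3[OF p] by simp
  \<comment> \<open>With one class each level has size at most 1, so three coefficients use every
    level once, in \<open>3! = 6\<close> orders; a fourth does not fit.\<close>
  show "rho p 2 3 = 1 - 6 * (type_weight p 0 * type_weight p 1 * type_weight p 2)"
    by (subst rho_eq[where G = "\<lambda>_. True", OF char]) (simp add: fact_numeral)
  show "rho p n 3 = 1" if "n \<ge> 3"
    by (rule rho_eq_1[where G = "\<lambda>_. True", OF char]) (use that in linarith)
qed

text \<open>Sizes \<open>(a, b, c)\<close> contribute \<open>(n + 1)! / 3 ^ (n + 1)\<close> times
  their binomials: \<open>6\<close> for \<open>(1, 1, 1)\<close>, \<open>2\<close> for
  \<open>(2, 1, 0)\<close>, \<open>8 / 3\<close> for \<open>(2, 2, 0)\<close>, \<open>8\<close> for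
  \<open>(2, 1, 1)\<close>, \<open>40 / 3\<close> for \<open>(2, 2, 1)\<close> and
  \<open>80 / 3\<close> for \<open>(2, 2, 2)\<close>. With levels of size at most 2, seven
  coefficients do not fit.\<close>

lemma rho_1_mod_3:
  assumes p: "prime p" "p mod 3 = 1"
  defines "w \<equiv> type_weight p"
  shows "rho p 2 3 = 1 - (6 * w 0 * w 1 * w 2 + 2 * (w 0 ^ 2 * w 1 + w 0 ^ 2 * w 2 + w 1 ^ 2 * w 0 + w 1 ^ 2 * w 2
           + w 2 ^ 2 * w 0 + w 2 ^ 2 * w 1))"
    and "rho p 3 3 = 1 - (8 / 3 * (w 0 ^ 2 * w 1 ^ 2 + w 0 ^ 2 * w 2 ^ 2 + w 1 ^ 2 * w 2 ^ 2)
           + 8 * (w 0 ^ 2 * w 1 * w 2 + w 0 * w 1 ^ 2 * w 2 + w 0 * w 1 * w 2 ^ 2))"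
    and "rho p 4 3 = 1 - 40 / 3 * (w 0 ^ 2 * w 1 ^ 2 * w 2 + w 0 ^ 2 * w 1 * w 2 ^ 2 + w 0 * w 1 ^ 2 * w 2 ^ 2)"
    and "rho p 5 3 = 1 - 80 / 3 * (w 0 ^ 2 * w 1 ^ 2 * w 2 ^ 2)"
    and "n \<ge> 6 \<Longrightarrow> rho p n 3 = 1"
proof -
  let ?G = "\<lambda>f. \<forall>r<3. f r \<le> (2::nat)"
  obtain K where K: "cube_classes p 0 3 3 K" and
    char: "\<And>n. \<forall>v L. (\<forall>i\<le>n. \<not> int p dvd L i) \<longrightarrow> (\<not> reduced_zero (int p) 0 n v L \<longleftrightarrow>
        inj_on (\<lambda>i. (v i mod 3, K (L i))) {..n} \<and> ?G (index_count n v))"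
  proof (rule not_reduced_zero_iff_1_mod_3[OF p])
    fix K assume "cube_classes p 0 3 3 K" and iff: "\<And>n v L. (\<And>i. i \<le> n \<Longrightarrow> \<not> int p dvd L i) \<Longrightarrow>
      \<not> reduced_zero (int p) 0 n v L \<longleftrightarrow>
        inj_on (\<lambda>i. (v i mod 3, K (L i))) {..n} \<and> ?G (index_count n v)"
    show thesis
      by (rule that[of K]) (fact, intro allI impI, rule iff, blast)
  qed
  interpret cube_classes p 0 3 3 K by (rule K)
  have G: "?G (triple_fun a b c) \<longleftrightarrow> a \<le> 2 \<and> b \<le> 2 \<and> c \<le> 2" for a b c
    unfolding all_less_3 by (simp add: triple_fun_def)
  note rho = rho_eq[where G = ?G, OF char, unfolded G sum_atMost_3 w_def[symmetric]]
  show "rho p 2 3 = 1 - (6 * w 0 * w 1 * w 2 + 2 * (w 0 ^ 2 * w 1 + w 0 ^ 2 * w 2 + w 1 ^ 2 * w 0 + w 1 ^ 2 * w 2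
           + w 2 ^ 2 * w 0 + w 2 ^ 2 * w 1))"
    by (subst rho) (simp_all add: choose_3 fact_numeral power2_eq_square field_simps)
  show "rho p 3 3 = 1 - (8 / 3 * (w 0 ^ 2 * w 1 ^ 2 + w 0 ^ 2 * w 2 ^ 2 + w 1 ^ 2 * w 2 ^ 2)
           + 8 * (w 0 ^ 2 * w 1 * w 2 + w 0 * w 1 ^ 2 * w 2 + w 0 * w 1 * w 2 ^ 2))"
    by (subst rho) (simp_all add: choose_3 fact_numeral power2_eq_square field_simps)
  show "rho p 4 3 = 1 - 40 / 3 * (w 0 ^ 2 * w 1 ^ 2 * w 2 + w 0 ^ 2 * w 1 * w 2 ^ 2 + w 0 * w 1 ^ 2 * w 2 ^ 2)"
    by (subst rho) (simp_all add: choose_3 fact_numeral power2_eq_square field_simps)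
  show "rho p 5 3 = 1 - 80 / 3 * (w 0 ^ 2 * w 1 ^ 2 * w 2 ^ 2)"
    by (subst rho) (simp_all add: choose_3 fact_numeral power2_eq_square field_simps)
  show "rho p n 3 = 1" if "n \<ge> 6"
    by (rule rho_eq_1[where G = ?G, OF char, unfolded G]) (use that in auto)
qed

text \<open>A level of size at least 2 has an empty successor and a predecessor of size at most 1,
  so at most \<open>3 + 1\<close> coefficients fit. Up to rotation the sizes are
  \<open>(1, 1, 1)\<close>, \<open>(3, 0, 0)\<close> and \<open>(2, 0, 1)\<close> for three
  coefficients and \<open>(3, 0, 1)\<close> for four.\<close>

lemma rho_3:
  shows "rho 3 2 3 = 13831 / 19773" and "rho 3 3 3 = 6391 / 6591" and "n \<ge> 4 \<Longrightarrow> rho 3 n 3 = 1"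
proof -
  let ?G = "\<lambda>f. \<forall>r<3. 2 \<le> f r \<longrightarrow> f (Suc r mod 3) = (0::nat)"
  interpret cube_classes 3 1 3 1 K9 by (rule cube_classes_3)
  have char: "\<forall>v L. (\<forall>i\<le>n. \<not> int 3 dvd L i) \<longrightarrow> (\<not> reduced_zero (int 3) 1 n v L \<longleftrightarrow>
        inj_on (\<lambda>i. (v i mod 3, K9 (L i))) {..n} \<and> ?G (index_count n v))" for n
    unfolding of_nat_numeral by (intro allI impI not_reduced_zero_iff_3) blast
  have G: "?G (triple_fun a b c) \<longleftrightarrow> (2 \<le> a \<longrightarrow> b = 0) \<and> (2 \<le> b \<longrightarrow> c = 0) \<and> (2 \<le> c \<longrightarrow> a = 0)" for a b c
  proof -
    have "Suc 0 mod 3 = 1" "Suc 1 mod 3 = 2" "Suc 2 mod 3 = 0" by simp_all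
    moreover have "triple_fun a b c 0 = a" "triple_fun a b c 1 = b" "triple_fun a b c 2 = c"
      by (simp_all add: triple_fun_def)
    ultimately show ?thesis unfolding all_less_3 by (simp only:)
  qed
  note rho = rho_eq[where G = ?G, OF char, unfolded G sum_atMost_3]
  have w: "type_weight 3 0 = 9 / 13" "type_weight 3 (Suc 0) = 3 / 13" "type_weight 3 2 = 1 / 13"
    by (simp_all add: type_weight_def power2_eq_square)
  show "rho 3 2 3 = 13831 / 19773"
    by (subst rho) (simp_all add: choose_3 w fact_numeral power2_eq_square power3_eq_cube)
  show "rho 3 3 3 = 6391 / 6591"
    by (subst rho) (simp_all add: choose_3 w fact_numeral power2_eq_square power3_eq_cube)
  show "rho 3 n 3 = 1" if "n \<ge> 4"
    by (rule rho_eq_1[where G = ?G, OF char, unfolded G]) (use that in auto)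
qed

lemma prime_mod_3_cases:
  assumes "prime (p::nat)"
  obtains "p = 3" | "p mod 3 = 1" | "p mod 3 = 2"
proof -
  have "p mod 3 = 0 \<or> p mod 3 = 1 \<or> p mod 3 = 2" by linarith
  moreover have "p = 3" if "p mod 3 = 0"
  proof -
    have "3 dvd p" using that by (simp add: mod_eq_0_iff_dvd)
    moreover have "prime (3::nat)" by simp
    ultimately show ?thesis using assms primes_dvd_imp_eq by blast
  qed
  ultimately show thesis using that by metis
qed

theorem theorem1p4:
  fixes p :: nat
  assumes "prime p"
  shows
  "(rho p 2 3 =
      (if p = 3 then 13831 / 19773
       else if p mod 3 = 1 then 1 - 2 * (1 / real p) * ((1 - 1 / real p) / (1 - 1 / real p ^ 3))
       else 1 - 6 * (1 / real p ^ 3) * ((1 - 1 / real p) / (1 - 1 / real p ^ 3)) ^ 3))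
   \<and> (rho p 3 3 =
      (if p = 3 then 6391 / 6591
       else if p mod 3 = 1 then 1 - 8 / 3 * (1 / real p ^ 2) * (1 + 1 / real p) ^ 2
                                 * ((1 - 1 / real p) / (1 - 1 / real p ^ 3)) ^ 3
       else 1))
   \<and> (rho p 4 3 =
      (if p mod 3 = 1 then 1 - 40 / 3 * (1 / real p ^ 4) * ((1 - 1 / real p) / (1 - 1 / real p ^ 3)) ^ 4
       else 1))
   \<and> (rho p 5 3 =
      (if p mod 3 = 1 then 1 - 80 / 3 * (1 / real p ^ 6) * ((1 - 1 / real p) / (1 - 1 / real p ^ 3)) ^ 6
       else 1))
   \<and> (\<forall>n\<ge>6. rho p n 3 = 1)"
proof -
  define u where "u = 1 / real p"
  define W where "W = (1 - u) / (1 - u ^ 3)"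
  have pow: "1 / real p ^ k = u ^ k" for k by (simp add: u_def power_one_over)
  have w: "type_weight p 0 = W" "type_weight p 1 = u * W" "type_weight p 2 = u ^ 2 * W"
    by (simp_all add: type_weight_def W_def pow u_def[symmetric])
  have "u < 1" "u > 0" using prime_gt_1_nat[OF assms] by (simp_all add: u_def)
  then have ne: "1 - u ^ 3 \<noteq> 0" using power_less_one_iff[of u 3] by simp
  \<comment> \<open>The three weights are the probabilities of the valuation classes and sum to 1;
    this factor can be split off wherever it makes an identity homogeneous.\<close>
  have "W * (1 + u + u ^ 2) = (1 - u) * (1 + u + u ^ 2) / (1 - u ^ 3)" by (simp add: W_def)
  also have "(1 - u) * (1 + u + u ^ 2) = 1 - u ^ 3"
    by (simp add: power2_eq_square power3_eq_cube algebra_simps)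
  finally have W1: "W * (1 + u + u ^ 2) = 1" using ne by simp
  show ?thesis
  proof (cases rule: prime_mod_3_cases[OF assms])
    case 1
    then show ?thesis using rho_3 by simp
  next
    case 2
    \<comment> \<open>For weights \<open>x\<close>, \<open>y\<close>, \<open>z\<close> the left side
      is \<open>2 * (x + y + z) * (x * y + y * z + z * x)\<close>, and the last factor is
      \<open>u * W * (x + y + z)\<close>.\<close>
    have "6 * W * (u * W) * (u ^ 2 * W) + 2 * (W ^ 2 * (u * W) + W ^ 2 * (u ^ 2 * W) + (u * W) ^ 2 * W
        + (u * W) ^ 2 * (u ^ 2 * W) + (u ^ 2 * W) ^ 2 * W + (u ^ 2 * W) ^ 2 * (u * W))
      = 2 * u * W * (W * (1 + u + u ^ 2)) ^ 2"
      by (simp add: eval_nat_numeral algebra_simps)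
    then have "rho p 2 3 = 1 - 2 * u * W"
      using rho_1_mod_3(1)[OF assms 2] unfolding w W1 by (simp only: power_one mult_1_right)
    \<comment> \<open>The left side is \<open>8 / 3\<close> times the square of the second
      elementary symmetric function plus the product of the first and third. As the weights sum to
      1, this is \<open>u ^ 2 * W ^ 2 * (1 + u * W)\<close>, and
      \<open>1 + u * W = W * (1 + u) ^ 2\<close>.\<close>
    moreover have "8 / 3 * (W ^ 2 * (u * W) ^ 2 + W ^ 2 * (u ^ 2 * W) ^ 2 + (u * W) ^ 2 * (u ^ 2 * W) ^ 2)
           + 8 * (W ^ 2 * (u * W) * (u ^ 2 * W) + W * (u * W) ^ 2 * (u ^ 2 * W) + W * (u * W) * (u ^ 2 * W) ^ 2)
      = 8 / 3 * u ^ 2 * (1 + u) ^ 2 * W ^ 3 * (W * (1 + u + u ^ 2))"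
      by (simp add: eval_nat_numeral algebra_simps)
    then have "rho p 3 3 = 1 - 8 / 3 * u ^ 2 * (1 + u) ^ 2 * W ^ 3"
      using rho_1_mod_3(2)[OF assms 2] unfolding w W1 by (simp only: power_one mult_1_right)
    moreover have "40 / 3 * (W ^ 2 * (u * W) ^ 2 * (u ^ 2 * W) + W ^ 2 * (u * W) * (u ^ 2 * W) ^ 2 + W * (u * W) ^ 2 * (u ^ 2 * W) ^ 2)
      = 40 / 3 * u ^ 4 * W ^ 4 * (W * (1 + u + u ^ 2))"
      by (simp add: eval_nat_numeral algebra_simps)
    then have "rho p 4 3 = 1 - 40 / 3 * u ^ 4 * W ^ 4"
      using rho_1_mod_3(3)[OF assms 2] unfolding w W1 by (simp only: power_one mult_1_right)
    moreover have "80 / 3 * (W ^ 2 * (u * W) ^ 2 * (u ^ 2 * W) ^ 2) = 80 / 3 * u ^ 6 * W ^ 6"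
      by (simp add: eval_nat_numeral algebra_simps)
    then have "rho p 5 3 = 1 - 80 / 3 * u ^ 6 * W ^ 6"
      using rho_1_mod_3(4)[OF assms 2] unfolding w by (simp only:)
    moreover have "p \<noteq> 3" using 2 by auto
    ultimately show ?thesis
      unfolding pow u_def[symmetric] W_def[symmetric] using 2 rho_1_mod_3(5)[OF assms 2] by simp
  next
    case 3
    have "6 * (W * (u * W) * (u ^ 2 * W)) = 6 * u ^ 3 * W ^ 3" by (simp add: eval_nat_numeral algebra_simps)
    then have "rho p 2 3 = 1 - 6 * u ^ 3 * W ^ 3"
      using rho_2_mod_3(1)[OF assms 3] unfolding w by (simp only:)
    moreover have "p \<noteq> 3" using 3 by auto
    ultimately show ?thesis
      unfolding pow u_def[symmetric] W_def[symmetric] using 3 rho_2_mod_3(2)[OF assms 3] by simp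
  qed
qed

end
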